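(* Let $\Omega$ be a countably infinite set, and let $f, g, h \in \mathrm{Inj}(\Omega)$ be any three maps, each having at least one infinite cycle. Then there exist permutations $a, b \in \mathrm{Sym}(\Omega)$ such that $h = afa^{-1}bgb^{-1}$ if and only if $|\Omega \setminus (\Omega)f| + |\Omega \setminus (\Omega)g| = |\Omega \setminus (\Omega)h|$.
   Context: $\mathrm{Inj}(\Omega)$ is the monoid of all injective maps $\Omega \to \Omega$, and $\mathrm{Sym}(\Omega)$ is the group of all permutations of $\Omega$. Maps are written on the right of their arguments, so $(\alpha)fg = ((\alpha)f)g$, and $(\Omega)f$ denotes the image of $f$. $|\cdot|$ denotes cardinality, and sums are sums of cardinals. For $f \in \mathrm{Inj}(\Omega)$, a nonempty set $\Sigma \subseteq \Omega$ is a cycle under $f$ if (i) for all $\alpha \in \Omega$, $(\alpha)f \in \Sigma$ if and only if $\alpha \in \Sigma$; and (ii) $\Sigma$ has no proper nonempty subset satisfying (i). An infinite cycle is a cycle that is an infinite set. (Equivalently, $f$ has an infinite cycle if there exists $\alpha \in \Omega$ with $\alpha \neq (\alpha)f^i$ for all positive integers $i$.) *)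

theory Defs
  imports "HOL-Library.Countable_Set" "HOL-Combinatorics.Permutations"
begin

unbundle cardinal_syntax

text \<open>
  Maps on the carrier \<open>\<Omega>\<close> are represented as in \<^const>\<open>permutes\<close>: by total functions that fix
  every point outside \<open>\<Omega>\<close>.  Such a representative is unique, so equality of functions is equality
  of maps on \<open>\<Omega>\<close>, and composition and inverse are the usual ones.
\<close>

definition Inj :: "'a set \<Rightarrow> ('a \<Rightarrow> 'a) set" where
  "Inj \<Omega> = {f. f ` \<Omega> \<subseteq> \<Omega> \<and> inj_on f \<Omega> \<and> (\<forall>x. x \<notin> \<Omega> \<longrightarrow> f x = x)}"

definition Sym :: "'a set \<Rightarrow> ('a \<Rightarrow> 'a) set" where
  "Sym \<Omega> = {p. p permutes \<Omega>}"

text \<open>Products are read with maps acting on the right: the left factor is applied first.\<close>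

abbreviation (input) right_comp :: "('a \<Rightarrow> 'a) \<Rightarrow> ('a \<Rightarrow> 'a) \<Rightarrow> 'a \<Rightarrow> 'a"
    (infixl \<open>\<Zcomp>\<close> 55) where
  "f \<Zcomp> g \<equiv> g \<circ> f"

definition closed_under :: "'a set \<Rightarrow> ('a \<Rightarrow> 'a) \<Rightarrow> 'a set \<Rightarrow> bool" where
  "closed_under \<Omega> f S \<longleftrightarrow> (\<forall>x\<in>\<Omega>. f x \<in> S \<longleftrightarrow> x \<in> S)"

definition is_cycle :: "'a set \<Rightarrow> ('a \<Rightarrow> 'a) \<Rightarrow> 'a set \<Rightarrow> bool" where
  "is_cycle \<Omega> f S \<longleftrightarrow>
     S \<noteq> {} \<and> S \<subseteq> \<Omega> \<and> closed_under \<Omega> f S \<and>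
     \<not> (\<exists>T. T \<subset> S \<and> T \<noteq> {} \<and> closed_under \<Omega> f T)"

definition has_infinite_cycle :: "'a set \<Rightarrow> ('a \<Rightarrow> 'a) \<Rightarrow> bool" where
  "has_infinite_cycle \<Omega> f \<longleftrightarrow> (\<exists>S. is_cycle \<Omega> f S \<and> infinite S)"

end

theory Submission
  imports Defs Complex_Main
begin

text \<open>
  Write \<open>F\<close> and \<open>G\<close> for the conjugates of \<open>f\<close> and \<open>g\<close>, so that the equation reads \<open>h = G \<circ> F\<close>.
  The points missed by \<open>h\<close> are then those missed by \<open>G\<close> together with the \<open>G\<close>-images of those missed
  by \<open>F\<close>, and conjugation does not change how many points are missed; this is the equality of
  cardinals (\<open>card_missed_comp\<close>, \<open>card_missed_conj\<close>).

  For the converse it is enough to build injections \<open>F\<close> and \<open>G\<close> of \<open>\<Omega>\<close> with \<open>h = G \<circ> F\<close> that have the same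
  cycle structure as \<open>f\<close> and \<open>g\<close>. The basic observation is that, \<open>h\<close> being given, each edge \<open>x \<mapsto> y\<close> of
  \<open>F\<close> forces exactly one edge \<open>y \<mapsto> h x\<close> of \<open>G\<close>, and that adding a new pair \<open>(x, y)\<close>, where \<open>x\<close> has no
  \<open>F\<close>-image and \<open>y\<close> no \<open>F\<close>-preimage yet, never makes \<open>F\<close> or \<open>G\<close> multivalued or non-injective: only the
  cycle structure has to be watched.

  Fix one infinite cycle of \<open>f\<close> and one of \<open>g\<close>, and split the points missed by \<open>h\<close> into two parts of the
  sizes of the points missed by \<open>f\<close> and by \<open>g\<close>. All other cycles of \<open>f\<close> are copied at once onto points
  far apart on an infinite orbit of \<open>h\<close>. The same is done for \<open>g\<close>, except that the points missed by \<open>G\<close>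
  must be the second part. Finally the points missed by \<open>F\<close>, to which no edge of \<open>F\<close> leads, get their
  \<open>G\<close>-images in the first part. Since the copies lie far apart, all edges forced by these choices
  on the remaining points are isolated. What is left is to complete the edges of \<open>F\<close> to
  a single infinite chain, and simultaneously those of \<open>G\<close>.

  That is done by a back-and-forth construction through finitely many extra edges
  (\<open>exists_assembly\<close>). The infinite orbit of \<open>h\<close> always supplies a fresh point \<open>q\<close> with \<open>q\<close> and \<open>h q\<close> both
  untouched. With its help one can give any point an image or a preimage, and link two components of \<open>F\<close>
  as \<open>t \<mapsto> q \<mapsto> s\<close>, where the end \<open>t\<close> of one is followed by the start \<open>s\<close> of the other; the forced edges
  \<open>q \<mapsto> h t\<close> and \<open>s \<mapsto> h q\<close> cannot close a cycle of \<open>G\<close>, as each has an untouched endpoint. Components of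
  \<open>G\<close> are linked in a dual way. In the limit \<open>F\<close> and \<open>G\<close>, off the copied cycles, are single infinite chains,
  and two such chains are conjugate as soon as both or neither have a first point (\<open>infinite_chains_conjugate\<close>).
\<close>

section \<open>Increasing unions\<close>

text \<open>
  The form of the back-and-forth argument used below: the good sets are the finite approximations,
  and each task can be met by enlarging the current one.
\<close>

lemma meet_countably_many_tasks:
  fixes good :: "'b set \<Rightarrow> bool" and task :: "'i \<Rightarrow> 'b set \<Rightarrow> bool"
  assumes I: "countable I" and N0: "good N0"
    and ext: "\<And>i N. i \<in> I \<Longrightarrow> good N \<Longrightarrow> \<exists>N'. N \<subseteq> N' \<and> good N' \<and> task i N'"
  shows "\<exists>N :: nat \<Rightarrow> 'b set. (\<forall>n. good (N n)) \<and> incseq N \<and> (\<forall>i\<in>I. \<exists>n. task i (N n))"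
proof -
  have step: "\<exists>N'. good N' \<and> (N \<subseteq> N' \<and> (I \<noteq> {} \<longrightarrow> task (from_nat_into I n) N'))"
    if "good N" for N n
    using ext[OF from_nat_into that, of n] that by (cases "I = {}") auto
  obtain N where N: "\<And>n. good (N n)"
    "\<And>n. N n \<subseteq> N (Suc n) \<and> (I \<noteq> {} \<longrightarrow> task (from_nat_into I n) (N (Suc n)))"
    using dependent_nat_choice[of "\<lambda>_. good"
        "\<lambda>n N N'. N \<subseteq> N' \<and> (I \<noteq> {} \<longrightarrow> task (from_nat_into I n) N')"] N0 step
    by metis
  have "\<exists>n. task i (N n)" if i: "i \<in> I" for i
  proof -
    obtain n where "from_nat_into I n = i" using from_nat_into_surj[OF I i] by auto
    then show ?thesis using N(2)[of n] i by auto
  qed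
  moreover have "incseq N" using N(2) by (simp add: incseq_SucI)
  ultimately show ?thesis using N(1) by (intro exI[of _ N]) simp
qed

lemma trancl_UN_incseq:
  assumes "incseq R" and "(x, y) \<in> (\<Union>n::nat. R n)\<^sup>+"
  shows "\<exists>n. (x, y) \<in> (R n)\<^sup>+"
  using assms(2)
proof induction
  case (base y)
  then show ?case by auto
next
  case (step y z)
  then obtain m n where "(x, y) \<in> (R m)\<^sup>+" "(y, z) \<in> R n" by auto
  moreover have "R m \<subseteq> R (max m n)" "R n \<subseteq> R (max m n)"
    using assms(1) by (simp_all add: incseqD)
  ultimately have "(x, y) \<in> (R (max m n))\<^sup>+" "(y, z) \<in> R (max m n)"
    using trancl_mono by blast+
  then show ?case by (meson trancl.trancl_into_trancl)
qed

lemma single_valued_UN_incseq: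
  assumes "incseq R" "\<And>n::nat. single_valued (R n)"
  shows "single_valued (\<Union>n. R n)"
proof (rule single_valuedI)
  fix x y z assume "(x, y) \<in> (\<Union>n. R n)" "(x, z) \<in> (\<Union>n. R n)"
  then obtain m n where "(x, y) \<in> R m" "(x, z) \<in> R n" by auto
  moreover have "R m \<subseteq> R (max m n)" "R n \<subseteq> R (max m n)"
    using assms(1) by (simp_all add: incseqD)
  ultimately show "y = z" using assms(2)[of "max m n"] by (auto dest: single_valuedD)
qed

section \<open>Components of partial injections\<close>

lemma Not_Range_rtrancl: "y \<notin> Range R \<Longrightarrow> (x, y) \<in> R\<^sup>* \<longleftrightarrow> x = y"
  using Not_Domain_rtrancl[of y "R\<inverse>" x] by (auto simp: rtrancl_converse)

lemma no_path_from_outside: "x \<notin> Field R \<Longrightarrow> x \<noteq> y \<Longrightarrow> (x, y) \<notin> R\<^sup>*"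
  by (simp add: Not_Domain_rtrancl Field_def)

lemma no_path_to_outside: "y \<notin> Field R \<Longrightarrow> x \<noteq> y \<Longrightarrow> (x, y) \<notin> R\<^sup>*"
  by (simp add: Not_Range_rtrancl Field_def)

lemma rtrancl_target_in: "(x, y) \<in> R\<^sup>* \<Longrightarrow> x \<in> Z \<Longrightarrow> R \<subseteq> Z \<times> Z \<Longrightarrow> y \<in> Z"
  by (induction rule: rtrancl_induct) auto

lemma rtrancl_source_in: "(x, y) \<in> R\<^sup>* \<Longrightarrow> y \<in> Z \<Longrightarrow> R \<subseteq> Z \<times> Z \<Longrightarrow> x \<in> Z"
  by (induction rule: converse_rtrancl_induct) auto

lemma wf_if_Domain_Range_disjoint:
  assumes "Domain R \<inter> Range R = {}"
  shows "wf R"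
  unfolding wf_eq_minimal
proof (intro allI impI)
  fix T x assume "x \<in> (T :: 'a set)"
  then show "\<exists>z\<in>T. \<forall>y. (y, z) \<in> R \<longrightarrow> y \<notin> T" using assms by (cases "x \<in> Range R \<and> (\<exists>y\<in>T. (y, x) \<in> R)") blast+
qed

lemma wf_source_above:
  assumes "wf R"
  obtains s where "(s, x) \<in> R\<^sup>*" "s \<notin> Range R"
proof -
  obtain s where "(s, x) \<in> R\<^sup>*" "\<And>y. (y, s) \<in> R \<Longrightarrow> (y, x) \<notin> R\<^sup>*"
    using wfE_min[OF assms, of x "{s. (s, x) \<in> R\<^sup>*}"] by auto
  then have "s \<notin> Range R" by (meson Range.cases converse_rtrancl_into_rtrancl)
  then show thesis using \<open>(s, x) \<in> R\<^sup>*\<close> that by blast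
qed

lemma wf_sink_below:
  assumes "wf (R\<inverse>)"
  obtains t where "(x, t) \<in> R\<^sup>*" "t \<notin> Domain R"
  using wf_source_above[OF assms, of x] by (auto simp: rtrancl_converse)

text \<open>
  For a relation that is single-valued in both directions, comparable points are exactly the points of
  one component, because every component is a directed path or a directed cycle.
\<close>

definition comparable :: "'a rel \<Rightarrow> 'a \<Rightarrow> 'a \<Rightarrow> bool" where
  "comparable R x y \<longleftrightarrow> (x, y) \<in> R\<^sup>* \<or> (y, x) \<in> R\<^sup>*"

lemma comparable_mono: "comparable R x y \<Longrightarrow> R \<subseteq> R' \<Longrightarrow> comparable R' x y"
  unfolding comparable_def using rtrancl_mono by blast

lemma comparable_sym: "comparable R x y \<longleftrightarrow> comparable R y x"
  by (auto simp: comparable_def)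

lemma comparable_common_source:
  "single_valued R \<Longrightarrow> (a, x) \<in> R\<^sup>* \<Longrightarrow> (a, y) \<in> R\<^sup>* \<Longrightarrow> comparable R x y"
  unfolding comparable_def by (rule single_valued_confluent)

lemma comparable_common_target:
  "single_valued (R\<inverse>) \<Longrightarrow> (x, a) \<in> R\<^sup>* \<Longrightarrow> (y, a) \<in> R\<^sup>* \<Longrightarrow> comparable R x y"
  using comparable_common_source[of "R\<inverse>" a x y] by (auto simp: comparable_def rtrancl_converse)

text \<open>
  In the application \<open>t'\<close> is the end of the component of \<open>t\<close> and \<open>s'\<close> the start of the component of
  \<open>s\<close>. Contrapositively, if \<open>t\<close> and \<open>s\<close> lie in different components, then linking \<open>t'\<close> to \<open>s'\<close> does not
  close a cycle.
\<close>

lemma comparable_source_sink: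
  assumes "single_valued R" "single_valued (R\<inverse>)"
    and "(t, t') \<in> R\<^sup>*" "(s', s) \<in> R\<^sup>*" "(s', t') \<in> R\<^sup>*"
  shows "comparable R t s"
proof -
  have "comparable R t s'" using comparable_common_target[OF assms(2,3,5)] .
  then show ?thesis
    using comparable_common_source[OF assms(1) _ assms(4)] assms(4)
    by (meson comparable_def rtrancl_trans)
qed

lemma comparable_if_linked:
  assumes "(t, t') \<in> R\<^sup>*" "(s', s) \<in> R\<^sup>*" "R \<subseteq> R'" "(t', q) \<in> R'" "(q, s') \<in> R'"
  shows "comparable R' t s"
proof -
  have *: "(t, t') \<in> R'\<^sup>*" "(s', s) \<in> R'\<^sup>*" using assms(1-3) rtrancl_mono by blast+
  have "(t, s') \<in> R'\<^sup>*"
    by (rule rtrancl_into_rtrancl[OF rtrancl_into_rtrancl[OF *(1) assms(4)] assms(5)])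
  from rtrancl_trans[OF this *(2)] show ?thesis by (simp add: comparable_def)
qed

section \<open>Infinite chains\<close>

text \<open>
  A set on which \<open>f\<close> acts as the successor on the integers or on the naturals, seen from a base point
  \<open>v\<close>. The condition on \<open>A - f ` A\<close> makes \<open>v\<close> the first point in the second case.
\<close>

definition infinite_chain :: "('a \<Rightarrow> 'a) \<Rightarrow> 'a set \<Rightarrow> 'a \<Rightarrow> bool" where
  "infinite_chain f A v \<longleftrightarrow> v \<in> A \<and> f ` A \<subseteq> A \<and> inj_on f A \<and> A - f ` A \<subseteq> {v}
     \<and> (\<forall>w\<in>A. \<exists>m n. (f ^^ m) w = (f ^^ n) v) \<and> inj (\<lambda>n. (f ^^ n) v)"

lemma funpow_closed: "f ` A \<subseteq> A \<Longrightarrow> x \<in> A \<Longrightarrow> (f ^^ n) x \<in> A"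
  by (induction n) auto

lemma funpow_cancel:
  "f ` A \<subseteq> A \<Longrightarrow> inj_on f A \<Longrightarrow> x \<in> A \<Longrightarrow> y \<in> A \<Longrightarrow> (f ^^ n) x = (f ^^ n) y \<Longrightarrow> x = y"
  by (induction n) (auto simp: funpow_closed dest: inj_onD)

lemma funpow_image_eq: "f ` A = A \<Longrightarrow> (f ^^ n) ` A = A"
proof (induction n)
  case (Suc n)
  have "(f ^^ Suc n) ` A = f ` ((f ^^ n) ` A)" by (simp add: image_comp)
  then show ?case using Suc by simp
qed simp

lemma funpow_transfer:
  fixes f :: "'a \<Rightarrow> 'a"
  assumes "(f ^^ m) u = (f ^^ n) v"
  shows "(f ^^ (k + m)) u = (f ^^ (k + n)) v"
  using assms by (simp add: funpow_add)

text \<open>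
  The points \<open>u\<close> and \<open>x\<close> have the same signed distance \<open>n - m\<close> from the base points \<open>v\<close> and \<open>w\<close>. Stating
  this by forward iterates avoids inverses of \<open>f\<close> and \<open>e\<close> and treats both kinds of chain together.
\<close>

definition corresponds ::
  "('a \<Rightarrow> 'a) \<Rightarrow> 'a \<Rightarrow> ('b \<Rightarrow> 'b) \<Rightarrow> 'b \<Rightarrow> 'a \<Rightarrow> 'b \<Rightarrow> bool" where
  "corresponds f v e w u x \<longleftrightarrow> (\<exists>m n. (f ^^ m) u = (f ^^ n) v \<and> (e ^^ m) x = (e ^^ n) w)"

lemma corresponds_sym: "corresponds f v e w u x \<longleftrightarrow> corresponds e w f v x u"
  by (auto simp: corresponds_def)

lemma corresponds_step: "corresponds f v e w u x \<Longrightarrow> corresponds f v e w (f u) (e x)"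
  unfolding corresponds_def
proof (elim exE conjE)
  fix m n assume "(f ^^ m) u = (f ^^ n) v" "(e ^^ m) x = (e ^^ n) w"
  then have "(f ^^ m) (f u) = (f ^^ Suc n) v" "(e ^^ m) (e x) = (e ^^ Suc n) w"
    by (simp_all add: funpow_swap1[symmetric])
  then show "\<exists>m n. (f ^^ m) (f u) = (f ^^ n) v \<and> (e ^^ m) (e x) = (e ^^ n) w" by blast
qed

text \<open>
  Points behind \<open>v\<close> need partners behind \<open>w\<close>, which is why \<open>w\<close> must not be a first point unless \<open>v\<close> is
  one.
\<close>

lemma corresponds_exists:
  assumes f: "infinite_chain f A v" and e: "infinite_chain e V w"
    and start: "v \<in> f ` A \<longrightarrow> w \<in> e ` V" and u: "u \<in> A"
  shows "\<exists>x\<in>V. corresponds f v e w u x"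
proof -
  obtain m n where mn: "(f ^^ m) u = (f ^^ n) v" using f u by (auto simp: infinite_chain_def)
  have e': "w \<in> V" "e ` V \<subseteq> V" using e by (auto simp: infinite_chain_def)
  then have wn: "(e ^^ k) w \<in> V" for k by (simp add: funpow_closed)
  show ?thesis
  proof (cases "w \<in> e ` V")
    case True
    then have "e ` V = V" using e by (auto simp: infinite_chain_def)
    then have "(e ^^ m) ` V = V" by (rule funpow_image_eq)
    then obtain x where "x \<in> V" "(e ^^ m) x = (e ^^ n) w" using wn[of n] by (metis imageE)
    then show ?thesis using mn by (auto simp: corresponds_def)
  next
    case False
    then have v: "v \<notin> f ` A" using start by blast
    have fA: "f ` A \<subseteq> A" "inj_on f A" "v \<in> A" using f by (auto simp: infinite_chain_def)
    \<comment> \<open>Otherwise cancelling \<open>n\<close> steps exhibits the first point \<open>v\<close> as an image.\<close>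
    have "m \<le> n"
    proof (rule ccontr)
      assume "\<not> m \<le> n"
      then obtain k where k: "m = n + Suc k" by (metis add_Suc_right less_imp_Suc_add not_le)
      have "(f ^^ n) ((f ^^ Suc k) u) = (f ^^ n) v" using mn unfolding k funpow_add by simp
      then have "(f ^^ Suc k) u = v"
        using funpow_cancel[OF fA(1,2) _ fA(3)] funpow_closed[OF fA(1) u] by blast
      then show False using v funpow_closed[OF fA(1) u, of k] by auto
    qed
    then have "(e ^^ m) ((e ^^ (n - m)) w) = (e ^^ n) w"
      by (metis funpow_add comp_apply le_add_diff_inverse)
    then show ?thesis using mn wn by (auto simp: corresponds_def)
  qed
qed

text \<open>
  Two pairs \<open>(m, n)\<close> and \<open>(k, l)\<close> for the same \<open>u\<close> satisfy \<open>n - m = l - k\<close>, because the iterates of \<open>v\<close>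
  are distinct.
\<close>

lemma corresponds_unique:
  assumes f: "infinite_chain f A v" and e: "infinite_chain e V w"
    and x: "x \<in> V" "corresponds f v e w u x" and y: "y \<in> V" "corresponds f v e w u y"
  shows "x = y"
proof -
  obtain m n where mn: "(f ^^ m) u = (f ^^ n) v" "(e ^^ m) x = (e ^^ n) w"
    using x(2) by (auto simp: corresponds_def)
  obtain k l where kl: "(f ^^ k) u = (f ^^ l) v" "(e ^^ k) y = (e ^^ l) w"
    using y(2) by (auto simp: corresponds_def)
  have "(f ^^ (k + n)) v = (f ^^ (m + l)) v"
    using funpow_transfer[OF mn(1), of k] funpow_transfer[OF kl(1), of m]
    by (simp add: add.commute)
  then have eq: "k + n = m + l" using f by (auto simp: infinite_chain_def dest: injD)
  have "(e ^^ (k + m)) x = (e ^^ (k + m)) y"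
    using funpow_transfer[OF mn(2), of k] funpow_transfer[OF kl(2), of m] eq
    by (simp add: add.commute)
  then show ?thesis
    using funpow_cancel[of e V x y "k + m"] e x(1) y(1) by (auto simp: infinite_chain_def)
qed

lemma infinite_chains_conjugate:
  assumes f: "infinite_chain f A v" and e: "infinite_chain e V w"
    and start: "v \<in> f ` A \<longleftrightarrow> w \<in> e ` V"
  shows "\<exists>a. bij_betw a A V \<and> (\<forall>u\<in>A. a (f u) = e (a u))"
proof -
  have "\<forall>u\<in>A. \<exists>x. x \<in> V \<and> corresponds f v e w u x"
    using corresponds_exists[OF f e] start by blast
  then obtain a where a: "\<And>u. u \<in> A \<Longrightarrow> a u \<in> V" "\<And>u. u \<in> A \<Longrightarrow> corresponds f v e w u (a u)"
    by metis
  have "inj_on a A"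
  proof (rule inj_onI)
    fix u u' assume "u \<in> A" "u' \<in> A" "a u = a u'"
    then show "u = u'"
      using corresponds_unique[OF e f, of u "a u" u'] a(2)[of u] a(2)[of u']
      by (simp add: corresponds_sym[of e])
  qed
  moreover have "x \<in> a ` A" if x: "x \<in> V" for x
  proof -
    obtain u where u: "u \<in> A" "corresponds f v e w u x"
      using corresponds_exists[OF e f _ x] start by (auto simp: corresponds_sym[of e])
    then have "x = a u" using corresponds_unique[OF f e x _ a(1) a(2)] by blast
    then show ?thesis using u(1) by blast
  qed
  ultimately have "bij_betw a A V" using a(1) by (auto simp: bij_betw_def)
  moreover have "a (f u) = e (a u)" if u: "u \<in> A" for u
  proof -
    have fu: "f u \<in> A" "e (a u) \<in> V" using f e u a(1) by (auto simp: infinite_chain_def)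
    show ?thesis
      using corresponds_unique[OF f e a(1)[OF fu(1)] a(2)[OF fu(1)] fu(2)]
        corresponds_step[OF a(2)[OF u]] .
  qed
  ultimately show ?thesis by blast
qed

text \<open>
  Turns the outcome of the back-and-forth construction, a relation, into a chain of a function:
  acyclicity makes the iterates distinct, and comparability makes every point an iterate of the base point
  \<open>w\<close> or conversely.
\<close>

lemma infinite_chain_of_relation:
  assumes E: "E \<subseteq> V \<times> V" "single_valued E" "single_valued (E\<inverse>)" "Domain E = V"
    and acyc: "acyclic E" and comp: "\<forall>x\<in>V. \<forall>y\<in>V. comparable E x y"
    and w: "w \<in> V" "V - Range E \<subseteq> {w}"
  shows "\<exists>e. infinite_chain e V w \<and> (\<forall>x\<in>V. (x, e x) \<in> E) \<and> e ` V = Range E"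
proof -
  have "\<forall>x\<in>V. \<exists>y. (x, y) \<in> E" using E(4) by blast
  then obtain e where e: "\<And>x. x \<in> V \<Longrightarrow> (x, e x) \<in> E" by metis
  have eV: "e ` V \<subseteq> V" using e E(1) by auto
  have ran: "e ` V = Range E"
  proof
    show "Range E \<subseteq> e ` V" using e E(1,2) by (fastforce dest: single_valuedD)
  qed (use e in blast)
  have inj: "inj_on e V"
  proof (rule inj_onI)
    fix x y assume "x \<in> V" "y \<in> V" "e x = e y"
    then show "x = y" using e[of x] e[of y] E(3) by (auto dest: single_valuedD)
  qed
  have path: "(x, (e ^^ Suc n) x) \<in> E\<^sup>+" if "x \<in> V" for x n
  proof (induction n)
    case (Suc n)
    have "((e ^^ Suc n) x, e ((e ^^ Suc n) x)) \<in> E" using funpow_closed[OF eV that] e by blast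
    then show ?case using Suc trancl_into_trancl by fastforce
  qed (use e that in auto)
  have iter: "\<exists>n. y = (e ^^ n) x" if "(x, y) \<in> E\<^sup>*" "x \<in> V" for x y
    using that(1)
  proof induction
    case base
    show ?case by (rule exI[of _ 0]) simp
  next
    case (step y z)
    then obtain n where n: "y = (e ^^ n) x" by blast
    then have "y \<in> V" using funpow_closed[OF eV that(2)] by simp
    then have "z = e y" using e[of y] step(2) E(2) by (auto dest: single_valuedD)
    then show ?case using n by (intro exI[of _ "Suc n"]) simp
  qed
  have "\<exists>m n. (e ^^ m) x = (e ^^ n) w" if x: "x \<in> V" for x
  proof -
    have "(x, w) \<in> E\<^sup>* \<or> (w, x) \<in> E\<^sup>*" using comp x w(1) by (auto simp: comparable_def)
    then show ?thesis
    proof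
      assume "(x, w) \<in> E\<^sup>*"
      then obtain m where "w = (e ^^ m) x" using iter x by blast
      then show ?thesis by (intro exI[of _ m] exI[of _ 0]) simp
    next
      assume "(w, x) \<in> E\<^sup>*"
      then obtain n where "x = (e ^^ n) w" using iter w(1) by blast
      then show ?thesis by (intro exI[of _ 0] exI[of _ n]) simp
    qed
  qed
  moreover have "inj (\<lambda>n. (e ^^ n) w)"
  proof (rule linorder_injI)
    fix i j :: nat assume "i < j"
    then obtain k where k: "j = Suc k + i" by (metis add.commute add_Suc less_imp_Suc_add)
    have "((e ^^ i) w, (e ^^ j) w) \<in> E\<^sup>+"
      using path[OF funpow_closed[OF eV w(1), of i], of k] unfolding k funpow_add by simp
    then show "(e ^^ i) w \<noteq> (e ^^ j) w" using acyc by (auto simp: acyclic_def)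
  qed
  ultimately have "infinite_chain e V w"
    using w eV inj ran by (auto simp: infinite_chain_def)
  then show ?thesis using e ran by blast
qed

text \<open>
  By minimality, a cycle consists of the points whose forward orbit meets that of any one of its points.
  A coincidence among the iterates of \<open>v\<close> would make \<open>v\<close> periodic, and then its finite orbit would be
  the whole cycle.
\<close>

lemma infinite_cycle_is_infinite_chain:
  assumes f: "f \<in> Inj \<Omega>" and inf: "has_infinite_cycle \<Omega> f"
  shows "\<exists>A v. A \<subseteq> \<Omega> \<and> infinite_chain f A v \<and> f ` (\<Omega> - A) \<subseteq> \<Omega> - A"
proof -
  obtain A where cyc: "is_cycle \<Omega> f A" and "infinite A"
    using inf by (auto simp: has_infinite_cycle_def)
  then have A: "A \<noteq> {}" "A \<subseteq> \<Omega>" "closed_under \<Omega> f A" "infinite A"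
    by (auto simp: is_cycle_def)
  have min: "T = A" if "T \<subseteq> A" "T \<noteq> {}" "closed_under \<Omega> f T" for T
    using cyc that unfolding is_cycle_def by blast
  have clo: "f x \<in> A \<longleftrightarrow> x \<in> A" if "x \<in> \<Omega>" for x using A(3) that by (auto simp: closed_under_def)
  have f\<Omega>: "f ` \<Omega> \<subseteq> \<Omega>" "inj_on f \<Omega>" using f by (auto simp: Inj_def)
  have fA: "f ` A \<subseteq> A" "inj_on f A" using clo A(2) f\<Omega>(2) by (auto intro: inj_on_subset)
  have out: "f ` (\<Omega> - A) \<subseteq> \<Omega> - A" using clo f\<Omega>(1) by auto
  \<comment> \<open>The base point is taken to be a first point of the cycle whenever there is one.\<close>
  obtain v where v: "v \<in> A" "A \<subseteq> f ` A \<or> v \<in> A - f ` A" using A(1) by blast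
  have reach: "\<exists>m n. (f ^^ m) w = (f ^^ n) v'" if w: "w \<in> A" and v': "v' \<in> A" for w v'
  proof -
    let ?T = "{w \<in> A. \<exists>m n. (f ^^ m) w = (f ^^ n) v'}"
    have "f x \<in> ?T \<longleftrightarrow> x \<in> ?T" if "x \<in> \<Omega>" for x
    proof
      assume "f x \<in> ?T"
      then obtain m n where "(f ^^ m) (f x) = (f ^^ n) v'" "f x \<in> A" by blast
      then have "(f ^^ Suc m) x = (f ^^ n) v'" "x \<in> A" using clo that by (auto simp: funpow_swap1)
      then show "x \<in> ?T" by blast
    next
      assume "x \<in> ?T"
      then obtain m n where "(f ^^ m) x = (f ^^ n) v'" "x \<in> A" by blast
      then have "(f ^^ m) (f x) = (f ^^ Suc n) v'" "f x \<in> A"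
        using clo that by (simp_all add: funpow_swap1[symmetric])
      then show "f x \<in> ?T" by blast
    qed
    moreover have "v' \<in> ?T" using v' by blast
    ultimately have "?T = A" by (intro min) (auto simp: closed_under_def)
    then show ?thesis using w by blast
  qed
  have "inj (\<lambda>n. (f ^^ n) v)"
  proof (rule linorder_injI, rule ccontr)
    fix i j :: nat assume "i < j" and "\<not> (f ^^ i) v \<noteq> (f ^^ j) v"
    then obtain k where k: "j = i + Suc k" "(f ^^ i) v = (f ^^ j) v"
      by (metis add_Suc_right less_imp_Suc_add)
    then have "(f ^^ i) ((f ^^ Suc k) v) = (f ^^ i) v" unfolding k(1) funpow_add by simp
    then have per: "(f ^^ Suc k) v = v"
      using funpow_cancel[OF fA _ v(1)] funpow_closed[OF fA(1) v(1)] by blast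
    let ?T = "(\<lambda>n. (f ^^ n) v) ` {..k}"
    have TA: "?T \<subseteq> A" using funpow_closed[OF fA(1) v(1)] by blast
    have img: "f ` ?T \<subseteq> ?T"
    proof (rule image_subsetI)
      fix x assume "x \<in> ?T"
      then obtain n where n: "n \<le> k" "x = (f ^^ n) v" by blast
      show "f x \<in> ?T"
      proof (cases "n = k")
        case True
        then have "f x = (f ^^ 0) v" using per n(2) by simp
        then show ?thesis by blast
      next
        case False
        then have "Suc n \<in> {..k}" "f x = (f ^^ Suc n) v" using n by auto
        then show ?thesis by blast
      qed
    qed
    have "f ` ?T = ?T"
      using img endo_inj_surj[of ?T f] inj_on_subset[OF fA(2) TA] by blast
    have "closed_under \<Omega> f ?T"
      unfolding closed_under_def
    proof (intro ballI iffI)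
      fix x assume x: "x \<in> \<Omega>" "f x \<in> ?T"
      then have "f x \<in> f ` ?T" using \<open>f ` ?T = ?T\<close> by simp
      then obtain y where "y \<in> ?T" "f x = f y" by (rule imageE)
      then have "x = y" using f\<Omega>(2) x(1) TA A(2) by (meson inj_onD subsetD)
      then show "x \<in> ?T" using \<open>y \<in> ?T\<close> by simp
    next
      fix x assume "x \<in> ?T"
      then show "f x \<in> ?T" using img by (rule rev_subsetD[OF imageI])
    qed
    then have "?T = A" using min[OF TA] by blast
    then show False using A(4) by (metis finite_atMost finite_imageI)
  qed
  moreover have "A - f ` A \<subseteq> {v}"
  proof
    fix w assume w: "w \<in> A - f ` A"
    then have v': "v \<notin> f ` A" using v(2) by blast
    obtain m n where mn: "(f ^^ m) w = (f ^^ n) v" using reach[of w v] w v(1) by blast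
    show "w \<in> {v}"
    proof (cases m n rule: linorder_cases)
      case less
      then obtain k where k: "n = m + Suc k" by (metis add_Suc_right less_imp_Suc_add)
      have "(f ^^ m) w = (f ^^ m) ((f ^^ Suc k) v)" using mn unfolding k funpow_add by simp
      then have "w = (f ^^ Suc k) v"
        using funpow_cancel[OF fA] funpow_closed[OF fA(1) v(1)] w by blast
      then show ?thesis using w funpow_closed[OF fA(1) v(1), of k] by auto
    next
      case equal
      then show ?thesis using mn funpow_cancel[OF fA] w v(1) by blast
    next
      case greater
      then obtain k where k: "m = n + Suc k" by (metis add_Suc_right less_imp_Suc_add)
      have "(f ^^ n) ((f ^^ Suc k) w) = (f ^^ n) v" using mn unfolding k funpow_add by simp
      then have "(f ^^ Suc k) w = v"
        using funpow_cancel[OF fA _ v(1)] funpow_closed[OF fA(1)] w by blast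
      then show ?thesis using v' funpow_closed[OF fA(1), of w k] w by auto
    qed
  qed
  ultimately have "infinite_chain f A v"
    using v(1) fA reach[OF _ v(1)] by (auto simp: infinite_chain_def)
  then show ?thesis using A(2) out by blast
qed

section \<open>Completing two partial injections to chains simultaneously\<close>

text \<open>
  The relations \<open>E0\<close> on \<open>V\<close> and \<open>S0\<close> on \<open>W\<close> are the edges of \<open>F\<close> and \<open>G\<close> that are prescribed from the
  outset, outside the copied cycles. The task is to find a bijection \<open>N\<close> from \<open>P\<close> to \<open>Q\<close>, the remaining
  edges of \<open>F\<close>, such that \<open>E0\<close> with \<open>N\<close>, and \<open>S0\<close> with the edges \<open>(y, h x)\<close> forced by the pairs \<open>(x, y)\<close> in
  \<open>N\<close>, are single chains. Thus \<open>P\<close> and \<open>Q\<close> are the points that still need an \<open>F\<close>-image and an \<open>F\<close>-preimage,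
  and \<open>Q\<close> and \<open>h ` P\<close> those that still need a \<open>G\<close>-image and a \<open>G\<close>-preimage. The sets \<open>A\<close> and \<open>B\<close>
  hold the first points of the chains, if there are any.
\<close>

locale two_chain_assembly =
  fixes h :: "'a \<Rightarrow> 'a" and P Q V W A B :: "'a set" and E0 S0 :: "'a rel"
  assumes inj_h: "inj_on h P"
    and E0: "single_valued E0" "single_valued (E0\<inverse>)" "wf E0" "wf (E0\<inverse>)" "E0 \<subseteq> V \<times> V"
    and S0: "single_valued S0" "single_valued (S0\<inverse>)" "wf S0" "wf (S0\<inverse>)" "S0 \<subseteq> W \<times> W"
    and P_E0: "P \<inter> Domain E0 = {}" and Q_E0: "Q \<inter> Range E0 = {}"
    and Q_S0: "Q \<inter> Domain S0 = {}" and hP_S0: "h ` P \<inter> Range S0 = {}"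
    and subs: "P \<subseteq> V" "Q \<subseteq> V" "Q \<subseteq> W" "h ` P \<subseteq> W"
    and V_out: "V \<subseteq> P \<union> Domain E0" and V_in: "V \<subseteq> Q \<union> Range E0 \<union> A"
    and W_out: "W \<subseteq> Q \<union> Domain S0" and W_in: "W \<subseteq> h ` P \<union> Range S0 \<union> B"
    and A: "\<And>x y. x \<in> A \<Longrightarrow> y \<in> A \<Longrightarrow> x = y" and B: "\<And>x y. x \<in> B \<Longrightarrow> y \<in> B \<Longrightarrow> x = y"
    and fresh: "\<And>X. finite X \<Longrightarrow>
      \<exists>q. {q, h q} \<subseteq> P \<inter> Q - (Field E0 \<union> Field S0 \<union> X) \<and> q \<noteq> h q"
begin

definition first_edges :: "'a rel \<Rightarrow> 'a rel" where
  "first_edges N = E0 \<union> N"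

definition second_edges :: "'a rel \<Rightarrow> 'a rel" where
  "second_edges N = S0 \<union> (\<lambda>(x, y). (y, h x)) ` N"

lemma edges_insert:
  "first_edges (insert (x, y) N) = insert (x, y) (first_edges N)"
  "second_edges (insert (x, y) N) = insert (y, h x) (second_edges N)"
  by (auto simp: first_edges_def second_edges_def)

lemma edges_mono:
  "N \<subseteq> N' \<Longrightarrow> first_edges N \<subseteq> first_edges N'"
  "N \<subseteq> N' \<Longrightarrow> second_edges N \<subseteq> second_edges N'"
  by (auto simp: first_edges_def second_edges_def)

definition placement :: "'a rel \<Rightarrow> bool" where
  "placement N \<longleftrightarrow> N \<subseteq> P \<times> Q \<and> single_valued N \<and> single_valued (N\<inverse>)"

text \<open>
  Well-foundedness in both directions says that, besides being acyclic, every component has a start and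
  an end, at which it can be linked to others. It is lost in the limit, where only acyclicity survives.
\<close>

definition finite_state :: "'a rel \<Rightarrow> bool" where
  "finite_state N \<longleftrightarrow> finite N \<and> placement N
     \<and> wf (first_edges N) \<and> wf ((first_edges N)\<inverse>)
     \<and> wf (second_edges N) \<and> wf ((second_edges N)\<inverse>)"

lemma placement_edges:
  assumes "placement N"
  shows "single_valued (first_edges N)" "single_valued ((first_edges N)\<inverse>)"
    "first_edges N \<subseteq> V \<times> V"
    "single_valued (second_edges N)" "single_valued ((second_edges N)\<inverse>)"
    "second_edges N \<subseteq> W \<times> W"
proof -
  have N: "N \<subseteq> P \<times> Q" "single_valued N" "single_valued (N\<inverse>)"
    using assms by (auto simp: placement_def)
  show "single_valued (first_edges N)"
    using N(1,2) E0(1) P_E0 unfolding single_valued_def first_edges_def by blast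
  show "single_valued ((first_edges N)\<inverse>)"
    using N(1,3) E0(2) Q_E0 unfolding single_valued_def first_edges_def by blast
  show "single_valued (second_edges N)"
    using N(1,3) S0(1) Q_S0 unfolding single_valued_def second_edges_def by auto
  show "single_valued ((second_edges N)\<inverse>)"
    using N(1,2) S0(2) hP_S0 inj_h unfolding single_valued_def second_edges_def inj_on_def
    by auto blast+
  show "first_edges N \<subseteq> V \<times> V"
    using N(1) E0(5) subs unfolding first_edges_def by blast
  have "(\<lambda>(x, y). (y, h x)) ` N \<subseteq> Q \<times> h ` P" using N(1) by auto
  also have "\<dots> \<subseteq> W \<times> W" using subs by blast
  finally show "second_edges N \<subseteq> W \<times> W" using S0(5) by (simp add: second_edges_def)
qed

text \<open>
  The excluded paths are those that the new edges \<open>(x, y)\<close> and \<open>(y, h x)\<close> would close to cycles.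
\<close>

lemma finite_state_insert:
  assumes "finite_state N" "x \<in> P - Domain N" "y \<in> Q - Range N"
    and "(y, x) \<notin> (first_edges N)\<^sup>*" "(h x, y) \<notin> (second_edges N)\<^sup>*"
  shows "finite_state (insert (x, y) N)"
proof -
  have conv: "(insert (a, b) R)\<inverse> = insert (b, a) (R\<inverse>)" for a b :: 'a and R by auto
  have "placement (insert (x, y) N)"
    using assms(1-3) unfolding finite_state_def placement_def single_valued_def by blast
  then show ?thesis
    using assms by (simp add: finite_state_def edges_insert conv wf_insert rtrancl_converse)
qed

lemma finite_state_fresh:
  assumes "finite_state N" "finite X"
  obtains q where "q \<in> P" "q \<in> Q" "h q \<in> Q" "q \<noteq> h q"
    "\<forall>z\<in>{q, h q}. z \<notin> X \<and> z \<notin> Field (first_edges N) \<and> z \<notin> Field (second_edges N)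
       \<and> z \<notin> Domain N \<and> z \<notin> Range N"
proof -
  let ?Y = "X \<union> Field N \<union> Field ((\<lambda>(x, y). (y, h x)) ` N)"
  have "finite ?Y" using assms by (auto simp: finite_state_def intro!: finite_Field)
  from fresh[OF this] obtain q
    where q: "{q, h q} \<subseteq> P \<inter> Q - (Field E0 \<union> Field S0 \<union> ?Y)" "q \<noteq> h q" by blast
  show thesis
  proof (rule that[of q])
    have "Domain N \<union> Range N \<union> Field (first_edges N) \<union> Field (second_edges N)
        \<subseteq> Field E0 \<union> Field S0 \<union> ?Y"
      unfolding first_edges_def second_edges_def Field_Un by (auto simp: Field_def)
    then show "\<forall>z\<in>{q, h q}. z \<notin> X \<and> z \<notin> Field (first_edges N) \<and> z \<notin> Field (second_edges N)
       \<and> z \<notin> Domain N \<and> z \<notin> Range N"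
      using q(1) by blast
  qed (use q in auto)
qed

lemma extend_source:
  assumes "finite_state N" "x \<in> P"
  shows "\<exists>N'. N \<subseteq> N' \<and> finite_state N' \<and> x \<in> Domain N'"
proof (cases "x \<in> Domain N")
  case False
  obtain q where q: "q \<in> Q" "q \<notin> {x, h x}" "q \<notin> Field (first_edges N)"
    "q \<notin> Field (second_edges N)" "q \<notin> Range N"
    by (rule finite_state_fresh[OF assms(1), of "{x, h x}"]) auto
  have "finite_state (insert (x, q) N)"
  proof (rule finite_state_insert[OF assms(1)])
    show "(q, x) \<notin> (first_edges N)\<^sup>*" using q by (intro no_path_from_outside) auto
    show "(h x, q) \<notin> (second_edges N)\<^sup>*" using q by (intro no_path_to_outside) auto
  qed (use q assms(2) False in auto)
  then show ?thesis by blast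
qed (use assms in blast)

lemma extend_target:
  assumes "finite_state N" "y \<in> Q"
  shows "\<exists>N'. N \<subseteq> N' \<and> finite_state N' \<and> y \<in> Range N'"
proof (cases "y \<in> Range N")
  case False
  obtain q where q: "q \<in> P" "q \<noteq> y" "h q \<noteq> y" "q \<notin> Field (first_edges N)"
    "h q \<notin> Field (second_edges N)" "q \<notin> Domain N"
    by (rule finite_state_fresh[OF assms(1), of "{y}"]) auto
  have "finite_state (insert (q, y) N)"
  proof (rule finite_state_insert[OF assms(1)])
    show "(y, q) \<notin> (first_edges N)\<^sup>*" using q by (intro no_path_to_outside) auto
    show "(h q, y) \<notin> (second_edges N)\<^sup>*" using q by (intro no_path_from_outside) auto
  qed (use q assms(2) False in auto)
  then show ?thesis by blast
qed (use assms in blast)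

text \<open>
  The end \<open>t'\<close> of the component of \<open>t\<close> is linked to the start \<open>s'\<close> of that of \<open>s\<close> through a fresh point
  \<open>q\<close>. The forced edges are \<open>(q, h t')\<close> and \<open>(s', h q)\<close>; a direct edge \<open>(t', s')\<close> would instead force
  \<open>(s', h t')\<close>, which may close a cycle.
\<close>

lemma link_first:
  assumes st: "finite_state N" and t: "t \<in> V" and inc: "\<not> comparable (first_edges N) t s"
    and s': "(s', s) \<in> (first_edges N)\<^sup>*" "s' \<in> Q - Range N"
  shows "\<exists>N'. N \<subseteq> N' \<and> finite_state N' \<and> comparable (first_edges N') t s"
proof -
  let ?E = "first_edges N"
  have pl: "placement N" and wf: "wf (?E\<inverse>)" using st by (auto simp: finite_state_def)
  note ed = placement_edges[OF pl]
  obtain t' where t': "(t, t') \<in> ?E\<^sup>*" "t' \<notin> Domain ?E" by (rule wf_sink_below[OF wf])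
  have "t' \<in> V" using rtrancl_target_in[OF t'(1) t ed(3)] .
  then have t'P: "t' \<in> P - Domain N" using V_out t'(2) by (auto simp: first_edges_def)
  have no_path: "(s', t') \<notin> ?E\<^sup>*"
    using inc comparable_source_sink[OF ed(1,2) t'(1) s'(1)] by (rule contrapos_nn)
  obtain q where q: "q \<in> P" "q \<in> Q" "q \<noteq> h q" "q \<notin> {t', h t', s'}" "h q \<notin> {t', h t', s'}"
    "q \<notin> Field ?E" "q \<notin> Field (second_edges N)" "h q \<notin> Field (second_edges N)"
    "q \<notin> Domain N" "q \<notin> Range N"
    by (rule finite_state_fresh[OF st, of "{t', h t', s'}"]) simp_all
  have st1: "finite_state (insert (t', q) N)"
  proof (rule finite_state_insert[OF st])
    show "(q, t') \<notin> ?E\<^sup>*" using q by (intro no_path_from_outside) auto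
    show "(h t', q) \<notin> (second_edges N)\<^sup>*" using q by (intro no_path_to_outside) auto
  qed (use q t'P in auto)
  have st2: "finite_state (insert (q, s') (insert (t', q) N))"
  proof (rule finite_state_insert[OF st1])
    have "(s', q) \<notin> ?E\<^sup>*" using q by (intro no_path_to_outside) auto
    then show "(s', q) \<notin> (first_edges (insert (t', q) N))\<^sup>*"
      using no_path by (simp add: edges_insert rtrancl_insert)
    have "h q \<notin> Field (second_edges (insert (t', q) N))"
      using q(3,5,8) unfolding edges_insert by simp
    then show "(h q, s') \<notin> (second_edges (insert (t', q) N))\<^sup>*"
      by (rule no_path_from_outside) (use q(5) in simp)
  qed (use q s' t'P in auto)
  let ?N = "(insert (q, s') (insert (t', q) N))"
  have "N \<subseteq> ?N" by blast
  moreover have "comparable (first_edges ?N) t s"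
    by (rule comparable_if_linked[OF t'(1) s'(1), of _ q])
      (simp_all add: edges_insert edges_mono[OF \<open>N \<subseteq> ?N\<close>, unfolded edges_insert])
  ultimately show ?thesis using st2 by (intro exI[of _ ?N] conjI)
qed

text \<open>
  A component can be entered at its start unless that start lies in \<open>A\<close>. As \<open>A\<close> has at most one element,
  two different components can be linked in at least one of the two orders.
\<close>

lemma extend_first_comparable:
  assumes st: "finite_state N" and ts: "t \<in> V" "s \<in> V"
  shows "\<exists>N'. N \<subseteq> N' \<and> finite_state N' \<and> comparable (first_edges N') t s"
proof (cases "comparable (first_edges N) t s")
  case inc: False
  let ?E = "first_edges N"
  have pl: "placement N" and wf: "wf ?E" using st by (auto simp: finite_state_def)
  note ed = placement_edges[OF pl]
  obtain s' where s': "(s', s) \<in> ?E\<^sup>*" "s' \<notin> Range ?E" by (rule wf_source_above[OF wf])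
  obtain t' where t': "(t', t) \<in> ?E\<^sup>*" "t' \<notin> Range ?E" by (rule wf_source_above[OF wf])
  have V': "s' \<in> V" "t' \<in> V"
    using rtrancl_source_in[OF s'(1) ts(2) ed(3)] rtrancl_source_in[OF t'(1) ts(1) ed(3)] .
  have "s' \<noteq> t'" using comparable_common_source[OF ed(1) t'(1)] s'(1) inc by blast
  then have "s' \<in> Q \<or> t' \<in> Q"
    using V_in V' s'(2) t'(2) A[of s' t'] by (auto simp: first_edges_def)
  then show ?thesis
  proof
    assume "s' \<in> Q"
    then show ?thesis using link_first[OF st ts(1) inc s'(1)] s'(2) by (auto simp: first_edges_def)
  next
    assume "t' \<in> Q"
    then show ?thesis
      using link_first[OF st ts(2) _ t'(1)] t'(2) inc
      by (auto simp: first_edges_def comparable_sym[of _ t s])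
  qed
qed (use st in blast)

text \<open>
  Dual to the linking in the first relation. For \<open>q\<close> fresh, the pairs \<open>(x, h q)\<close> and \<open>(q, t')\<close> force the
  edges \<open>(h q, h x)\<close> and \<open>(t', h q)\<close>, which run from the end \<open>t'\<close> of the component of \<open>t\<close> through
  \<open>h q\<close> to the start \<open>h x\<close> of that of \<open>s\<close>.
\<close>

lemma link_second:
  assumes st: "finite_state N" and t: "t \<in> W" and inc: "\<not> comparable (second_edges N) t s"
    and s': "(h x, s) \<in> (second_edges N)\<^sup>*" and x: "x \<in> P - Domain N"
  shows "\<exists>N'. N \<subseteq> N' \<and> finite_state N' \<and> comparable (second_edges N') t s"
proof -
  let ?S = "second_edges N"
  have pl: "placement N" and wf: "wf (?S\<inverse>)" using st by (auto simp: finite_state_def)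
  note ed = placement_edges[OF pl]
  obtain t' where t': "(t, t') \<in> ?S\<^sup>*" "t' \<notin> Domain ?S" by (rule wf_sink_below[OF wf])
  have "t' \<in> W" using rtrancl_target_in[OF t'(1) t ed(6)] .
  then have t'Q: "t' \<in> Q - Range N" using W_out t'(2) by (force simp: second_edges_def)
  have no_path: "(h x, t') \<notin> ?S\<^sup>*"
    using inc comparable_source_sink[OF ed(4,5) t'(1) s'] by (rule contrapos_nn)
  obtain q where q: "q \<in> P" "h q \<in> Q" "q \<noteq> h q" "q \<notin> {t', x, h x}" "h q \<notin> {t', x, h x}"
    "q \<notin> Field (first_edges N)" "h q \<notin> Field (first_edges N)" "h q \<notin> Field ?S"
    "q \<notin> Domain N" "h q \<notin> Range N"
    by (rule finite_state_fresh[OF st, of "{t', x, h x}"]) simp_all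
  have st1: "finite_state (insert (x, h q) N)"
  proof (rule finite_state_insert[OF st])
    show "(h q, x) \<notin> (first_edges N)\<^sup>*" using q by (intro no_path_from_outside) auto
    show "(h x, h q) \<notin> ?S\<^sup>*" using q by (intro no_path_to_outside) auto
  qed (use q x in auto)
  have st2: "finite_state (insert (q, t') (insert (x, h q) N))"
  proof (rule finite_state_insert[OF st1])
    have "(h q, t') \<notin> ?S\<^sup>*" using q by (intro no_path_from_outside) auto
    then show "(h q, t') \<notin> (second_edges (insert (x, h q) N))\<^sup>*"
      using no_path by (simp add: edges_insert rtrancl_insert)
    have "q \<notin> Field (first_edges (insert (x, h q) N))"
      using q(3,4,6) unfolding edges_insert by simp
    then show "(t', q) \<notin> (first_edges (insert (x, h q) N))\<^sup>*"
      by (rule no_path_to_outside) (use q(4) in auto)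
  qed (use q x t'Q in auto)
  let ?N = "(insert (q, t') (insert (x, h q) N))"
  have "N \<subseteq> ?N" by blast
  moreover have "comparable (second_edges ?N) t s"
    by (rule comparable_if_linked[OF t'(1) s', of _ "h q"])
      (simp_all add: edges_insert edges_mono[OF \<open>N \<subseteq> ?N\<close>, unfolded edges_insert])
  ultimately show ?thesis using st2 by (intro exI[of _ ?N] conjI)
qed

lemma extend_second_comparable:
  assumes st: "finite_state N" and ts: "t \<in> W" "s \<in> W"
  shows "\<exists>N'. N \<subseteq> N' \<and> finite_state N' \<and> comparable (second_edges N') t s"
proof (cases "comparable (second_edges N) t s")
  case inc: False
  let ?S = "second_edges N"
  have pl: "placement N" and wf: "wf ?S" using st by (auto simp: finite_state_def)
  note ed = placement_edges[OF pl]
  obtain s' where s': "(s', s) \<in> ?S\<^sup>*" "s' \<notin> Range ?S" by (rule wf_source_above[OF wf])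
  obtain t' where t': "(t', t) \<in> ?S\<^sup>*" "t' \<notin> Range ?S" by (rule wf_source_above[OF wf])
  have W': "s' \<in> W" "t' \<in> W"
    using rtrancl_source_in[OF s'(1) ts(2) ed(6)] rtrancl_source_in[OF t'(1) ts(1) ed(6)] .
  have old: "s' \<notin> Range S0" "t' \<notin> Range S0"
    using s'(2) t'(2) by (simp_all add: second_edges_def Range_Un_eq)
  have new: "\<exists>x \<in> P - Domain N. z = h x" if z: "z \<in> h ` P" "z \<notin> Range ?S" for z
  proof -
    obtain x where x: "x \<in> P" "z = h x" using z(1) by blast
    have "x \<notin> Domain N"
    proof
      assume "x \<in> Domain N"
      then obtain y where "(x, y) \<in> N" by blast
      then have "(y, z) \<in> ?S" using x(2) by (force simp: second_edges_def)
      then show False using z(2) by blast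
    qed
    then show ?thesis using x by blast
  qed
  have "s' \<noteq> t'" using comparable_common_source[OF ed(4) t'(1)] s'(1) inc by blast
  then have "s' \<in> h ` P \<or> t' \<in> h ` P"
    using W_in W' B[of s' t'] old by blast
  then show ?thesis
  proof
    assume "s' \<in> h ` P"
    then obtain x where x: "x \<in> P - Domain N" "s' = h x" using new s'(2) by blast
    show ?thesis using link_second[OF st ts(1) inc _ x(1)] s'(1) x(2) by simp
  next
    assume "t' \<in> h ` P"
    then obtain x where x: "x \<in> P - Domain N" "t' = h x" using new t'(2) by blast
    have "\<not> comparable ?S s t" using inc by (simp add: comparable_sym)
    from link_second[OF st ts(2) this _ x(1)] show ?thesis
      using t'(1) x(2) by (simp add: comparable_sym[of _ t s])
  qed
qed (use st in blast)

theorem exists_assembly: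
  assumes "countable V" "countable W"
  shows "\<exists>N. placement N \<and> Domain N = P \<and> Range N = Q
     \<and> acyclic (first_edges N) \<and> (\<forall>x\<in>V. \<forall>y\<in>V. comparable (first_edges N) x y)
     \<and> acyclic (second_edges N) \<and> (\<forall>x\<in>W. \<forall>y\<in>W. comparable (second_edges N) x y)"
proof -
  define task where "task = (\<lambda>(x, y) N. (x \<in> P \<longrightarrow> x \<in> Domain N) \<and> (x \<in> Q \<longrightarrow> x \<in> Range N)
    \<and> (x \<in> V \<longrightarrow> y \<in> V \<longrightarrow> comparable (first_edges N) x y)
    \<and> (x \<in> W \<longrightarrow> y \<in> W \<longrightarrow> comparable (second_edges N) x y))"
  have ext: "\<exists>N'. N \<subseteq> N' \<and> finite_state N' \<and> task i N'"
    if "i \<in> (V \<union> W) \<times> (V \<union> W)" and st: "finite_state N" for i N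
  proof -
    obtain x y where i: "i = (x, y)" by fastforce
    obtain N1 where N1: "N \<subseteq> N1" "finite_state N1" "x \<in> P \<longrightarrow> x \<in> Domain N1"
      using extend_source[OF st] st by blast
    obtain N2 where N2: "N1 \<subseteq> N2" "finite_state N2" "x \<in> Q \<longrightarrow> x \<in> Range N2"
      using extend_target[OF N1(2)] N1(2) by blast
    obtain N3 where N3: "N2 \<subseteq> N3" "finite_state N3"
      "x \<in> V \<and> y \<in> V \<longrightarrow> comparable (first_edges N3) x y"
      using extend_first_comparable[OF N2(2)] N2(2) by blast
    obtain N4 where N4: "N3 \<subseteq> N4" "finite_state N4"
      "x \<in> W \<and> y \<in> W \<longrightarrow> comparable (second_edges N4) x y"
      using extend_second_comparable[OF N3(2)] N3(2) by blast
    have "x \<in> V \<and> y \<in> V \<longrightarrow> comparable (first_edges N4) x y"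
      using N3(3) comparable_mono[OF _ edges_mono(1)[OF N4(1)]] by blast
    moreover have "x \<in> P \<longrightarrow> x \<in> Domain N4" "x \<in> Q \<longrightarrow> x \<in> Range N4"
      using N1(3) N2(1,3) N3(1) N4(1) by blast+
    ultimately have "task i N4" using N4(3) by (simp add: task_def i)
    moreover have "N \<subseteq> N4" using N1(1) N2(1) N3(1) N4(1) by (meson subset_trans)
    ultimately show ?thesis using N4(2) by (intro exI[of _ N4] conjI)
  qed
  have start: "finite_state {}"
    using E0 S0 by (simp add: finite_state_def placement_def first_edges_def second_edges_def)
  have "countable ((V \<union> W) \<times> (V \<union> W))" using assms by simp
  from meet_countably_many_tasks[of _ finite_state "{}" task, OF this start ext]
  obtain N where N: "\<And>n::nat. finite_state (N n)" "incseq N"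
    "\<And>i. i \<in> (V \<union> W) \<times> (V \<union> W) \<Longrightarrow> \<exists>n. task i (N n)" by blast
  define M where "M = (\<Union>n. N n)"
  have sub: "N n \<subseteq> M" for n by (auto simp: M_def)
  have pl: "placement (N n)" for n using N(1) by (simp add: finite_state_def)
  have "incseq (\<lambda>n. (N n)\<inverse>)" using N(2) by (auto simp: incseq_def)
  then have "single_valued M" "single_valued (M\<inverse>)"
    using single_valued_UN_incseq[OF N(2)] single_valued_UN_incseq[of "\<lambda>n. (N n)\<inverse>"] pl
    by (auto simp: M_def placement_def converse_UNION)
  then have plM: "placement M" using pl by (auto simp: placement_def M_def)
  have inc: "incseq (\<lambda>n. first_edges (N n))" "incseq (\<lambda>n. second_edges (N n))"
    using N(2) edges_mono by (auto simp: incseq_def)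
  have U: "first_edges M = (\<Union>n. first_edges (N n))" "second_edges M = (\<Union>n. second_edges (N n))"
    by (auto simp: first_edges_def second_edges_def M_def)
  have "acyclic (first_edges (N n))" "acyclic (second_edges (N n))" for n
    using N(1)[of n] by (auto simp: finite_state_def wf_acyclic)
  then have ac: "acyclic (first_edges M)" "acyclic (second_edges M)"
    using trancl_UN_incseq[OF inc(1)] trancl_UN_incseq[OF inc(2)] unfolding U acyclic_def by blast+
  have met: "task (x, y) M" if xy: "x \<in> V \<union> W" "y \<in> V \<union> W" for x y
  proof -
    obtain n where "task (x, y) (N n)" using N(3)[of "(x, y)"] xy by auto
    then show ?thesis
      using sub[of n] comparable_mono[OF _ edges_mono(1)[OF sub[of n]]]
        comparable_mono[OF _ edges_mono(2)[OF sub[of n]]]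
      unfolding task_def by blast
  qed
  have "P \<subseteq> Domain M" "Q \<subseteq> Range M"
    using met subs unfolding task_def by blast+
  then have "Domain M = P" "Range M = Q"
    using plM unfolding placement_def by auto
  moreover have "\<forall>x\<in>V. \<forall>y\<in>V. comparable (first_edges M) x y"
    "\<forall>x\<in>W. \<forall>y\<in>W. comparable (second_edges M) x y"
    using met unfolding task_def by blast+
  ultimately show ?thesis using plM ac by blast
qed

end

section \<open>Conjugates with a prescribed product\<close>

text \<open>
  The conjugating bijection follows the given copy \<open>\<alpha>\<close> outside the chain \<open>A\<close> of \<open>f\<close>, and identifies \<open>A\<close>
  with the chain formed by the relation \<open>E\<close> on the rest of \<open>\<Omega>\<close>. The condition on \<open>V - Range E\<close> gives \<open>E\<close> a
  first point precisely if \<open>A\<close> has one.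
\<close>

lemma conjugation_from_chain:
  assumes chain: "infinite_chain f A v" and A: "A \<subseteq> \<Omega>" and out: "f ` (\<Omega> - A) \<subseteq> \<Omega> - A"
    and \<alpha>: "inj_on \<alpha> \<Omega>" "\<alpha> ` \<Omega> \<subseteq> \<Omega>"
    and V: "V = \<Omega> - \<alpha> ` (\<Omega> - A)" "V \<noteq> {}"
    and E: "E \<subseteq> V \<times> V" "single_valued E" "single_valued (E\<inverse>)" "Domain E = V"
      "acyclic E" "\<forall>x\<in>V. \<forall>y\<in>V. comparable E x y"
    and start: "V - Range E = \<alpha> ` (A - f ` A)"
  shows "\<exists>a. bij_betw a \<Omega> \<Omega> \<and> (\<forall>u\<in>\<Omega> - A. a u = \<alpha> u) \<and> (\<forall>u\<in>A. a u \<in> V \<and> (a u, a (f u)) \<in> E)"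
proof -
  have v: "v \<in> A" "A - f ` A \<subseteq> {v}" "f ` A \<subseteq> A" using chain by (auto simp: infinite_chain_def)
  obtain w where w: "w \<in> V" "V - Range E \<subseteq> {w}" "v \<in> f ` A \<longleftrightarrow> w \<in> Range E"
  proof (cases "v \<in> f ` A")
    case True
    then have "A - f ` A = {}" using v(2) by blast
    then have "V \<subseteq> Range E" using start by auto
    moreover obtain w where "w \<in> V" using V(2) by blast
    ultimately show ?thesis using that[of w] True by auto
  next
    case False
    then have "A - f ` A = {v}" using v by blast
    then have "V - Range E = {\<alpha> v}" using start by simp
    then show ?thesis using that[of "\<alpha> v"] False by auto
  qed
  obtain e where e: "infinite_chain e V w" "\<And>x. x \<in> V \<Longrightarrow> (x, e x) \<in> E" "e ` V = Range E"
    using infinite_chain_of_relation[OF E w(1,2)] by blast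
  obtain a1 where a1: "bij_betw a1 A V" "\<And>u. u \<in> A \<Longrightarrow> a1 (f u) = e (a1 u)"
    using infinite_chains_conjugate[OF chain e(1)] w(3) e(3) by auto
  define a where "a u = (if u \<in> A then a1 u else \<alpha> u)" for u
  have "bij_betw a A V" using a1(1) by (rule bij_betw_cong[THEN iffD1, rotated]) (simp add: a_def)
  moreover have "bij_betw a (\<Omega> - A) (\<alpha> ` (\<Omega> - A))"
    using inj_on_subset[OF \<alpha>(1), of "\<Omega> - A"] by (auto simp: bij_betw_def inj_on_def a_def)
  ultimately have "bij_betw a (A \<union> (\<Omega> - A)) (V \<union> \<alpha> ` (\<Omega> - A))"
    by (rule bij_betw_combine) (auto simp: V(1))
  moreover have "A \<union> (\<Omega> - A) = \<Omega>" "V \<union> \<alpha> ` (\<Omega> - A) = \<Omega>" using A \<alpha>(2) by (auto simp: V(1))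
  ultimately have "bij_betw a \<Omega> \<Omega>" by simp
  moreover have "a u \<in> V \<and> (a u, a (f u)) \<in> E" if u: "u \<in> A" for u
  proof -
    have "a1 u \<in> V" using a1(1) u by (auto dest: bij_betwE)
    moreover have "f u \<in> A" using v(3) u by blast
    ultimately show ?thesis using e(2)[of "a1 u"] a1(2)[OF u] u by (simp add: a_def)
  qed
  ultimately show ?thesis by (intro exI[of _ a]) (simp add: a_def)
qed

text \<open>
  The conclusion says that \<open>h\<close> is the product of the conjugates of \<open>f\<close> by \<open>a\<close> and of \<open>g\<close> by \<open>b\<close>, without
  mention of inverses. Points \<open>c i\<close> of an infinite orbit of \<open>h\<close> are used according to \<open>i\<close> modulo \<open>8\<close>: the
  class \<open>1\<close> receives the copy \<open>\<alpha>\<close> of \<open>f\<close> and the class \<open>4\<close>, together with the set \<open>MG\<close> of points to be missed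
  by \<open>G\<close>, the copy \<open>\<beta>\<close> of \<open>g\<close>. The edges forced by the copies involve also the \<open>h\<close>-successors of class \<open>1\<close>
  and the \<open>h\<close>-predecessors of class \<open>4\<close>, that is the classes \<open>2\<close> and \<open>3\<close>. The classes \<open>6\<close> and \<open>7\<close> stay
  free and serve as fresh points.
\<close>

lemma product_of_conjugates:
  fixes \<Omega> :: "'a set" and f g h :: "'a \<Rightarrow> 'a" and \<theta> :: "'a + 'a \<Rightarrow> 'a"
  assumes \<Omega>: "countable \<Omega>" and fgh: "f \<in> Inj \<Omega>" "g \<in> Inj \<Omega>" "h \<in> Inj \<Omega>"
    and fchain: "A \<subseteq> \<Omega>" "infinite_chain f A v" "f ` (\<Omega> - A) \<subseteq> \<Omega> - A"
    and gchain: "B \<subseteq> \<Omega>" "infinite_chain g B w" "g ` (\<Omega> - B) \<subseteq> \<Omega> - B"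
    and orbit: "z \<in> \<Omega>" "inj (\<lambda>n. (h ^^ n) z)"
    and \<theta>: "bij_betw \<theta> ((\<Omega> - f ` \<Omega>) <+> (\<Omega> - g ` \<Omega>)) (\<Omega> - h ` \<Omega>)"
  shows "\<exists>a b. bij_betw a \<Omega> \<Omega> \<and> bij_betw b \<Omega> \<Omega>
     \<and> (\<forall>u\<in>\<Omega>. \<forall>x\<in>\<Omega>. a (f u) = b x \<longrightarrow> b (g x) = h (a u))"
proof -
  have f: "f ` \<Omega> \<subseteq> \<Omega>" "inj_on f \<Omega>" and g: "g ` \<Omega> \<subseteq> \<Omega>" "inj_on g \<Omega>"
    and h: "h ` \<Omega> \<subseteq> \<Omega>" "inj_on h \<Omega>"
    using fgh by (auto simp: Inj_def)
  have fA: "f ` A \<subseteq> A" "A - f ` A \<subseteq> {v}" and gB: "g ` B \<subseteq> B" "B - g ` B \<subseteq> {w}"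
    using fchain(2) gchain(2) by (auto simp: infinite_chain_def)
  define n where "n = to_nat_on \<Omega>"
  have n: "n x = n y \<longleftrightarrow> x = y" if "x \<in> \<Omega>" "y \<in> \<Omega>" for x y
    using inj_on_to_nat_on[OF \<Omega>] that by (auto simp: n_def dest: inj_onD)
  \<comment> \<open>Starting with an image of \<open>h\<close> keeps all \<open>c i\<close> away from the points missed by \<open>h\<close>.\<close>
  define c where "c i = (h ^^ Suc i) z" for i
  have c_eq: "c i = c j \<longleftrightarrow> i = j" for i j using orbit(2) by (auto simp: c_def simp del: funpow.simps dest: injD)
  have hc: "h (c i) = c (Suc i)" for i by (simp add: c_def)
  have hc3: "h (c (8 * k + 3)) = c (8 * k + 4)" and hc6: "h (c (8 * k + 6)) = c (8 * k + 7)" for k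
    using hc[of "8 * k + 3"] hc[of "8 * k + 6"] by (simp_all add: add.commute)
  have c_im: "c i \<in> h ` \<Omega>" for i using funpow_closed[OF h(1) orbit(1)] by (simp add: c_def)
  have c\<Omega>: "c i \<in> \<Omega>" for i using c_im h(1) by blast
  define K where "K j = range (\<lambda>k. c (8 * k + j))" for j
  have K\<Omega>: "K j \<subseteq> \<Omega>" and K_im: "K j \<subseteq> h ` \<Omega>" for j using c\<Omega> c_im by (auto simp: K_def)
  have K_disj: "K i \<inter> K j = {}" if "i \<noteq> j" "i < 8" "j < 8" for i j
  proof -
    have "8 * k + i \<noteq> 8 * l + j" for k l
    proof
      assume "8 * k + i = 8 * l + j"
      then have "(8 * k + i) mod 8 = (8 * l + j) mod 8" by simp
      then show False using that by simp
    qed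
    then show ?thesis by (auto simp: K_def c_eq)
  qed
  \<comment> \<open>The points missed by \<open>h\<close>, split into the \<open>G\<close>-images \<open>MF\<close> of the points missed by \<open>F\<close> and the
    points \<open>MG\<close> missed by \<open>G\<close>.\<close>
  define MF where "MF = \<theta> ` Inl ` (\<Omega> - f ` \<Omega>)"
  define MG where "MG = \<theta> ` Inr ` (\<Omega> - g ` \<Omega>)"
  have \<theta>_im: "\<theta> ` (Inl ` (\<Omega> - f ` \<Omega>) \<union> Inr ` (\<Omega> - g ` \<Omega>)) = \<Omega> - h ` \<Omega>"
    and \<theta>_inj: "inj_on \<theta> (Inl ` (\<Omega> - f ` \<Omega>) \<union> Inr ` (\<Omega> - g ` \<Omega>))"
    using \<theta> by (auto simp: bij_betw_def Plus_def)
  have M: "MF \<union> MG = \<Omega> - h ` \<Omega>" using \<theta>_im by (simp add: MF_def MG_def image_Un)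
  have M_disj: "MF \<inter> MG = {}"
    unfolding MF_def MG_def by (subst inj_on_image_Int[OF \<theta>_inj, symmetric]) auto
  have \<theta>_Inl: "\<theta> (Inl x) = \<theta> (Inl y) \<Longrightarrow> x = y" if "x \<in> \<Omega> - f ` \<Omega>" "y \<in> \<Omega> - f ` \<Omega>" for x y
    using inj_onD[OF \<theta>_inj, of "Inl x" "Inl y"] that by simp
  have \<theta>_Inr: "\<theta> (Inr x) = \<theta> (Inr y) \<Longrightarrow> x = y" if "x \<in> \<Omega> - g ` \<Omega>" "y \<in> \<Omega> - g ` \<Omega>" for x y
    using inj_onD[OF \<theta>_inj, of "Inr x" "Inr y"] that by simp
  have KM: "K j \<inter> MF = {}" "K j \<inter> MG = {}" for j using K_im M by blast+

  define \<alpha> where "\<alpha> u = c (8 * n u + 1)" for u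
  define \<beta> where "\<beta> u = (if u \<in> g ` \<Omega> then c (8 * n u + 4) else \<theta> (Inr u))" for u
  have \<alpha>K: "\<alpha> u \<in> K 1" for u by (simp add: \<alpha>_def K_def)
  have h\<alpha>: "h (\<alpha> u) = c (8 * n u + 2)" for u by (simp add: \<alpha>_def hc)
  have h\<alpha>K: "h (\<alpha> u) \<in> K 2" for u by (simp add: h\<alpha> K_def)
  have \<alpha>_eq: "\<alpha> u = \<alpha> u' \<longleftrightarrow> u = u'" if "u \<in> \<Omega>" "u' \<in> \<Omega>" for u u'
    using n that by (simp add: \<alpha>_def c_eq)
  have \<beta>K: "\<beta> u \<in> K 4" if "u \<in> g ` \<Omega>" for u using that by (simp add: \<beta>_def K_def)
  have \<beta>M: "\<beta> u \<in> MG" if "u \<in> \<Omega> - g ` \<Omega>" for u using that by (auto simp: \<beta>_def MG_def)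
  have \<beta>_eq: "\<beta> u = \<beta> u' \<longleftrightarrow> u = u'" if u: "u \<in> \<Omega>" "u' \<in> \<Omega>" for u u'
  proof
    assume eq: "\<beta> u = \<beta> u'"
    consider "u \<in> g ` \<Omega>" "u' \<in> g ` \<Omega>" | "u \<notin> g ` \<Omega>" "u' \<notin> g ` \<Omega>"
      | "u \<in> g ` \<Omega>" "u' \<notin> g ` \<Omega>" | "u \<notin> g ` \<Omega>" "u' \<in> g ` \<Omega>" by blast
    then show "u = u'"
    proof cases
      case 1 then show ?thesis using eq n[OF u] by (simp add: \<beta>_def c_eq)
    next
      case 2 then show ?thesis using eq \<theta>_Inr[of u u'] u by (simp add: \<beta>_def)
    next
      case 3 then show ?thesis using eq \<beta>K[of u] \<beta>M[of u'] u KM(2)[of 4] by auto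
    next
      case 4 then show ?thesis using eq \<beta>K[of u'] \<beta>M[of u] u KM(2)[of 4] by auto
    qed
  qed simp
  have \<alpha>\<Omega>: "\<alpha> ` \<Omega> \<subseteq> \<Omega>" using \<alpha>K K\<Omega> by blast
  have \<beta>\<Omega>: "\<beta> ` \<Omega> \<subseteq> \<Omega>" using \<beta>K \<beta>M K\<Omega>[of 4] M by blast
  have \<alpha>_inj: "inj_on \<alpha> \<Omega>" and \<beta>_inj: "inj_on \<beta> \<Omega>" using \<alpha>_eq \<beta>_eq by (auto intro: inj_onI)

  \<comment> \<open>\<open>XF\<close> and \<open>XG\<close> carry the copied cycles, and \<open>D\<close> consists of the points to be missed by \<open>F\<close>.\<close>
  define XF where "XF = \<alpha> ` (\<Omega> - A)"
  define XG where "XG = \<beta> ` (\<Omega> - B)"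
  define D where "D = \<alpha> ` (\<Omega> - f ` \<Omega>)"
  define V where "V = \<Omega> - XF"
  define W where "W = \<Omega> - XG"
  \<comment> \<open>An edge from \<open>\<beta> x\<close> to \<open>\<beta> (g x)\<close> of the copy of \<open>g\<close> requires \<open>F\<close> to send the \<open>h\<close>-preimage of
    \<open>\<beta> (g x)\<close>, a point of class \<open>3\<close>, to \<open>\<beta> x\<close>.\<close>
  define E0 where "E0 = (\<lambda>x. (c (8 * n (g x) + 3), \<beta> x)) ` (\<Omega> - B)"
  \<comment> \<open>An edge from \<open>\<alpha> u\<close> to \<open>\<alpha> (f u)\<close> of the copy of \<open>f\<close> forces the first kind of edge of \<open>G\<close>; the
    second kind is the free choice of \<open>G\<close> at the points missed by \<open>F\<close>.\<close>
  define S0 where "S0 = (\<lambda>u. (\<alpha> (f u), h (\<alpha> u))) ` (\<Omega> - A) \<union> (\<lambda>u. (\<alpha> u, \<theta> (Inl u))) ` (\<Omega> - f ` \<Omega>)"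
  define P where "P = V - Domain E0"
  define Q where "Q = \<Omega> - XF - XG - D"
  have MG\<beta>: "MG = \<beta> ` (\<Omega> - g ` \<Omega>)" by (auto simp: MG_def \<beta>_def image_iff)
  have XF: "XF \<subseteq> K 1" "D \<subseteq> K 1" using \<alpha>K by (auto simp: XF_def D_def)
  have XG: "XG \<subseteq> K 4 \<union> MG" using \<beta>K \<beta>M by (auto simp: XG_def)
  have DE0: "Domain E0 \<subseteq> K 3" and RE0: "Range E0 = XG" by (auto simp: E0_def XG_def K_def)
  have \<Omega>f: "u \<in> f ` (\<Omega> - A) \<or> u \<in> \<Omega> - f ` \<Omega>" if "u \<in> \<Omega> - A" for u using that fA(1) by blast
  have DS0: "Domain S0 = XF \<union> D"
  proof
    show "Domain S0 \<subseteq> XF \<union> D" using fchain(3) by (auto simp: S0_def XF_def D_def)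
    show "XF \<union> D \<subseteq> Domain S0"
    proof
      fix x assume "x \<in> XF \<union> D"
      then obtain u where u: "x = \<alpha> u" "u \<in> f ` (\<Omega> - A) \<or> u \<in> \<Omega> - f ` \<Omega>"
        using \<Omega>f by (auto simp: XF_def D_def)
      then show "x \<in> Domain S0" by (force simp: S0_def)
    qed
  qed
  have RS0: "Range S0 = h ` XF \<union> MF" by (force simp: S0_def XF_def MF_def)
  have hXF: "h ` XF \<subseteq> K 2" using h\<alpha>K by (auto simp: XF_def)
  have disj: "K 1 \<inter> K 2 = {}" "K 1 \<inter> K 3 = {}" "K 1 \<inter> K 4 = {}" "K 2 \<inter> K 4 = {}" "K 3 \<inter> K 4 = {}"
    by (simp_all add: K_disj)
  have XFV: "XF \<subseteq> \<Omega>" and XGV: "XG \<subseteq> \<Omega>" and D\<Omega>: "D \<subseteq> \<Omega>"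
    using XF XG K\<Omega> M by blast+

  have DXF: "D - XF = \<alpha> ` (A - f ` A)"
  proof -
    have "D - XF = \<alpha> ` ((\<Omega> - f ` \<Omega>) - (\<Omega> - A))"
      unfolding D_def XF_def by (rule inj_on_image_set_diff[OF \<alpha>_inj, symmetric]) auto
    also have "(\<Omega> - f ` \<Omega>) - (\<Omega> - A) = A - f ` A" using fchain(1,3) by auto
    finally show ?thesis .
  qed
  have MGXG: "MG - XG = \<beta> ` (B - g ` B)"
  proof -
    have "MG - XG = \<beta> ` ((\<Omega> - g ` \<Omega>) - (\<Omega> - B))"
      unfolding MG\<beta> XG_def by (rule inj_on_image_set_diff[OF \<beta>_inj, symmetric]) auto
    also have "(\<Omega> - g ` \<Omega>) - (\<Omega> - B) = B - g ` B" using gchain(1,3) by auto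
    finally show ?thesis .
  qed
  have P\<Omega>: "P \<subseteq> \<Omega>" by (auto simp: P_def V_def)
  have DE0V: "Domain E0 \<subseteq> V" and RE0V: "Range E0 \<subseteq> V"
    using DE0 RE0 XG XGV XF disj K\<Omega>[of 3] KM(2)[of 1] unfolding V_def by blast+
  have DS0W: "Domain S0 \<subseteq> W"
    using DS0 XF XG XFV D\<Omega> disj(3) KM(2)[of 1] unfolding W_def by blast
  have RS0W: "Range S0 \<subseteq> W"
  proof -
    have "(K 2 \<union> MF) \<inter> (K 4 \<union> MG) = {}"
      using disj(4) M_disj KM(1)[of 4] KM(2)[of 2]
      by (simp add: Int_Un_distrib Int_Un_distrib2 Int_commute[of MF "K 4"])
    moreover have "Range S0 \<subseteq> K 2 \<union> MF" using RS0 hXF by auto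
    moreover have "K 2 \<union> MF \<subseteq> \<Omega>" using K\<Omega>[of 2] M by auto
    ultimately show ?thesis using XG unfolding W_def by fast
  qed

  interpret two_chain_assembly h P Q V W "D - XF" "MG - XG" E0 S0
  proof
    show "inj_on h P" using h(2) by (rule inj_on_subset) (auto simp: P_def V_def)
    show "single_valued E0"
    proof (rule single_valuedI)
      fix x y y' assume "(x, y) \<in> E0" "(x, y') \<in> E0"
      then obtain u u' where u: "u \<in> \<Omega> - B" "u' \<in> \<Omega> - B" "y = \<beta> u" "y' = \<beta> u'"
        "c (8 * n (g u) + 3) = c (8 * n (g u') + 3)" by (auto simp: E0_def)
      then have "n (g u) = n (g u')" by (simp add: c_eq)
      then have "g u = g u'" using n[of "g u" "g u'"] g(1) u(1,2) by blast
      then have "u = u'" using g(2) u(1,2) by (auto dest: inj_onD)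
      then show "y = y'" using u by simp
    qed
    show "single_valued (E0\<inverse>)"
    proof (rule single_valuedI)
      fix x y y' assume "(x, y) \<in> E0\<inverse>" "(x, y') \<in> E0\<inverse>"
      then obtain u u' where u: "u \<in> \<Omega> - B" "u' \<in> \<Omega> - B" "\<beta> u = \<beta> u'"
        "y = c (8 * n (g u) + 3)" "y' = c (8 * n (g u') + 3)" by (auto simp: E0_def)
      then show "y = y'" using \<beta>_eq[of u u'] by simp
    qed
    have "Domain E0 \<inter> Range E0 = {}" using DE0 RE0 XG disj(5) KM(2)[of 3] by blast
    then show "wf E0" "wf (E0\<inverse>)" by (simp_all add: wf_if_Domain_Range_disjoint Int_commute)
    show "E0 \<subseteq> V \<times> V" using DE0V RE0V by auto
    have S0_cases: "(\<exists>u\<in>\<Omega> - A. x = \<alpha> (f u) \<and> y = h (\<alpha> u)) \<or> (\<exists>u\<in>\<Omega> - f ` \<Omega>. x = \<alpha> u \<and> y = \<theta> (Inl u))"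
      if "(x, y) \<in> S0" for x y using that by (auto simp: S0_def)
    show "single_valued S0"
    proof (rule single_valuedI)
      fix x y y' assume "(x, y) \<in> S0" "(x, y') \<in> S0"
      from this[THEN S0_cases] show "y = y'"
      proof (elim disjE bexE conjE)
        fix u u' assume u: "u \<in> \<Omega> - A" "u' \<in> \<Omega> - A" "x = \<alpha> (f u)" "x = \<alpha> (f u')"
          and y: "y = h (\<alpha> u)" "y' = h (\<alpha> u')"
        then have "f u \<in> \<Omega>" "f u' \<in> \<Omega>" "\<alpha> (f u) = \<alpha> (f u')" using f(1) by auto
        then have "f u = f u'" using \<alpha>_eq by simp
        then have "u = u'" using f(2) u(1,2) by (auto dest: inj_onD)
        then show ?thesis using y by simp
      next
        fix u u' assume u: "u \<in> \<Omega> - A" "u' \<in> \<Omega> - f ` \<Omega>" "x = \<alpha> (f u)" "x = \<alpha> u'"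
        then have "f u \<in> \<Omega>" "\<alpha> (f u) = \<alpha> u'" using f(1) by auto
        then have "f u = u'" using \<alpha>_eq u(2) by simp
        then show ?thesis using u(1,2) by blast
      next
        fix u u' assume u: "u \<in> \<Omega> - f ` \<Omega>" "u' \<in> \<Omega> - A" "x = \<alpha> u" "x = \<alpha> (f u')"
        then have "f u' \<in> \<Omega>" "\<alpha> (f u') = \<alpha> u" using f(1) by auto
        then have "f u' = u" using \<alpha>_eq u(1) by simp
        then show ?thesis using u(1,2) by blast
      next
        fix u u' assume u: "u \<in> \<Omega> - f ` \<Omega>" "u' \<in> \<Omega> - f ` \<Omega>" "x = \<alpha> u" "x = \<alpha> u'"
          and y: "y = \<theta> (Inl u)" "y' = \<theta> (Inl u')"
        have "u = u'" using \<alpha>_eq[of u u'] u by simp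
        then show ?thesis using y by simp
      qed
    qed
    show "single_valued (S0\<inverse>)"
    proof (rule single_valuedI)
      fix x y y' assume "(x, y) \<in> S0\<inverse>" "(x, y') \<in> S0\<inverse>"
      then have "(y, x) \<in> S0" "(y', x) \<in> S0" by auto
      from this[THEN S0_cases] show "y = y'"
      proof (elim disjE bexE conjE)
        fix u u' assume u: "u \<in> \<Omega> - A" "u' \<in> \<Omega> - A" "x = h (\<alpha> u)" "x = h (\<alpha> u')"
          and y: "y = \<alpha> (f u)" "y' = \<alpha> (f u')"
        then have "u = u'" using n[of u u'] by (simp add: h\<alpha> c_eq)
        then show ?thesis using y by simp
      next
        fix u u' assume u: "u' \<in> \<Omega> - f ` \<Omega>" "x = h (\<alpha> u)" "x = \<theta> (Inl u')"
        have "x \<in> MF" unfolding MF_def u(3) using u(1) by blast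
        moreover have "x \<in> K 2" using u(2) h\<alpha>K[of u] by simp
        ultimately show ?thesis using KM(1)[of 2] by blast
      next
        fix u u' assume u: "u \<in> \<Omega> - f ` \<Omega>" "x = \<theta> (Inl u)" "x = h (\<alpha> u')"
        have "x \<in> MF" unfolding MF_def u(2) using u(1) by blast
        moreover have "x \<in> K 2" using u(3) h\<alpha>K[of u'] by simp
        ultimately show ?thesis using KM(1)[of 2] by blast
      next
        fix u u' assume u: "u \<in> \<Omega> - f ` \<Omega>" "u' \<in> \<Omega> - f ` \<Omega>" "x = \<theta> (Inl u)" "x = \<theta> (Inl u')"
          and y: "y = \<alpha> u" "y' = \<alpha> u'"
        then show ?thesis using \<theta>_Inl[of u u'] by simp
      qed
    qed
    have "Domain S0 \<inter> Range S0 = {}" using DS0 RS0 XF hXF disj(1) KM(1)[of 1] by blast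
    then show "wf S0" "wf (S0\<inverse>)" by (simp_all add: wf_if_Domain_Range_disjoint Int_commute)
    show "S0 \<subseteq> W \<times> W" using DS0W RS0W by auto
    show "P \<inter> Domain E0 = {}" "Q \<inter> Range E0 = {}" "Q \<inter> Domain S0 = {}"
      using RE0 DS0 by (auto simp: P_def Q_def)
    show "h ` P \<inter> Range S0 = {}"
    proof -
      have "h x \<notin> h ` XF" if "x \<in> P" for x
      proof
        assume "h x \<in> h ` XF"
        then have "x \<in> XF" using h(2) P\<Omega> XFV that by (meson inj_on_image_mem_iff subsetD)
        then show False using that by (simp add: P_def V_def)
      qed
      moreover have "h ` P \<inter> MF = {}" using P\<Omega> M by blast
      ultimately show ?thesis using RS0 by blast
    qed
    show "P \<subseteq> V" "Q \<subseteq> V" "Q \<subseteq> W" by (auto simp: P_def Q_def V_def W_def)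
    show "h ` P \<subseteq> W"
    proof
      fix y assume "y \<in> h ` P"
      then obtain x where x: "x \<in> P" "y = h x" by blast
      then have y: "y \<in> h ` \<Omega>" using P\<Omega> by blast
      have "y \<notin> XG"
      proof
        assume "y \<in> XG"
        then obtain u where u: "u \<in> \<Omega> - B" "y = \<beta> u" by (auto simp: XG_def)
        then have "u \<in> g ` \<Omega>" using \<beta>M[of u] M y by blast
        then obtain t where t: "t \<in> \<Omega> - B" "u = g t" using gB(1) u(1) by blast
        have "h x = h (c (8 * n u + 3))"
          using u(2) x(2) \<open>u \<in> g ` \<Omega>\<close> by (simp add: \<beta>_def hc3)
        then have "x = c (8 * n u + 3)" using h(2) P\<Omega> x(1) c\<Omega> by (meson inj_onD subsetD)
        then have "x \<in> Domain E0" using t by (force simp: E0_def)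
        then show False using x(1) by (simp add: P_def)
      qed
      then show "y \<in> W" using y h(1) by (auto simp: W_def)
    qed
    show "V \<subseteq> P \<union> Domain E0" by (auto simp: P_def)
    show "V \<subseteq> Q \<union> Range E0 \<union> (D - XF)" using RE0 by (auto simp: V_def Q_def)
    show "W \<subseteq> Q \<union> Domain S0" using DS0 by (auto simp: W_def Q_def)
    show "W \<subseteq> h ` P \<union> Range S0 \<union> (MG - XG)"
    proof
      fix y assume y: "y \<in> W"
      show "y \<in> h ` P \<union> Range S0 \<union> (MG - XG)"
      proof (cases "y \<in> h ` \<Omega>")
        case True
        then obtain x where x: "x \<in> \<Omega>" "y = h x" by blast
        have "x \<notin> Domain E0"
        proof
          assume "x \<in> Domain E0"
          then obtain u where u: "u \<in> \<Omega> - B" "x = c (8 * n (g u) + 3)" by (auto simp: E0_def)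
          then have "y = \<beta> (g u)" using x(2) by (simp add: \<beta>_def hc3)
          then have "y \<in> XG" using gchain(3) u(1) by (auto simp: XG_def)
          then show False using y by (simp add: W_def)
        qed
        then have "x \<in> XF \<or> x \<in> P" using x(1) by (auto simp: P_def V_def)
        then show ?thesis using RS0 x(2) by blast
      next
        case False
        then have "y \<in> MF \<union> MG" using M y by (auto simp: W_def)
        then show ?thesis using RS0 y by (auto simp: W_def)
      qed
    qed
    show "x = y" if "x \<in> D - XF" "y \<in> D - XF" for x y
    proof -
      have "D - XF \<subseteq> {\<alpha> v}" using fA(2) unfolding DXF by auto
      then show ?thesis using that by blast
    qed
    show "x = y" if "x \<in> MG - XG" "y \<in> MG - XG" for x y
    proof -
      have "MG - XG \<subseteq> {\<beta> w}" using gB(2) unfolding MGXG by auto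
      then show ?thesis using that by blast
    qed
    show "\<exists>q. {q, h q} \<subseteq> P \<inter> Q - (Field E0 \<union> Field S0 \<union> X) \<and> q \<noteq> h q" if "finite X" for X
    proof -
      have "finite ((\<lambda>k. c (8 * k + 6)) -` X \<union> (\<lambda>k. c (8 * k + 7)) -` X)"
        using that by (intro finite_UnI finite_vimageI) (auto simp: inj_on_def c_eq)
      from ex_new_if_finite[OF infinite_UNIV_nat this]
      obtain k where k: "c (8 * k + 6) \<notin> X" "c (8 * k + 7) \<notin> X" by auto
      let ?q = "c (8 * k + 6)"
      have hq: "h ?q = c (8 * k + 7)" by (rule hc6)
      have q: "?q \<in> K 6" "h ?q \<in> K 7" by (auto simp: hq K_def)
      have F: "Field E0 \<subseteq> K 3 \<union> K 4 \<union> MG" "Field S0 \<subseteq> K 1 \<union> K 2 \<union> MF"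
        using DE0 RE0 XG DS0 RS0 XF hXF by (auto simp: Field_def)
      have "(K 6 \<union> K 7) \<inter> (K 1 \<union> K 2 \<union> K 3 \<union> K 4) = {}"
        by (simp add: Int_Un_distrib Int_Un_distrib2 K_disj)
      moreover have "(K 6 \<union> K 7) \<inter> (MF \<union> MG) = {}"
        by (simp add: Int_Un_distrib Int_Un_distrib2 KM)
      moreover have "{?q, h ?q} \<subseteq> K 6 \<union> K 7" using q by simp
      ultimately have away: "{?q, h ?q} \<inter> (K 1 \<union> K 2 \<union> K 3 \<union> K 4 \<union> MF \<union> MG) = {}" by blast
      have "P \<inter> Q \<supseteq> \<Omega> - (K 1 \<union> K 3 \<union> K 4 \<union> MG)"
        using XF XG DE0 unfolding P_def Q_def V_def by blast
      then have "{?q, h ?q} \<subseteq> P \<inter> Q" using away c\<Omega> hq by auto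
      moreover have "{?q, h ?q} \<inter> (Field E0 \<union> Field S0) = {}" using away F by blast
      moreover have "{?q, h ?q} \<inter> X = {}" using k hq by simp
      ultimately have "{?q, h ?q} \<subseteq> P \<inter> Q - (Field E0 \<union> Field S0 \<union> X)" by blast
      moreover have "?q \<noteq> h ?q" by (simp add: hq c_eq)
      ultimately show ?thesis by blast
    qed
  qed

  have "countable V" "countable W"
    using \<Omega> by (auto simp: V_def W_def intro: countable_subset)
  then obtain N where N: "placement N" "Domain N = P" "Range N = Q"
    and EN: "acyclic (first_edges N)" "\<forall>x\<in>V. \<forall>y\<in>V. comparable (first_edges N) x y"
    and SN: "acyclic (second_edges N)" "\<forall>x\<in>W. \<forall>y\<in>W. comparable (second_edges N) x y"
    using exists_assembly by blast
  note ed = placement_edges[OF N(1)]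
  obtain q where q: "q \<in> P" "q \<in> Q" using fresh[of "{}"] by auto
  have DE: "Domain (first_edges N) = V"
    using N(2) DE0V by (auto simp: first_edges_def P_def Domain_Un_eq)
  have RE: "V - Range (first_edges N) = \<alpha> ` (A - f ` A)"
  proof -
    have "Range (first_edges N) = XG \<union> Q" using N(3) RE0 by (simp add: first_edges_def Range_Un_eq)
    moreover have "D \<inter> XG = {}" using XF XG disj(3) KM(2)[of 1] by blast
    ultimately have "V - Range (first_edges N) = D - XF" using D\<Omega> by (auto simp: V_def Q_def)
    then show ?thesis by (simp only: DXF)
  qed
  have DS: "Domain (second_edges N) = W"
  proof -
    have "Domain ((\<lambda>(x, y). (y, h x)) ` N) = Range N" by force
    then show ?thesis
      using DS0 DS0W N(3) by (auto simp: second_edges_def W_def Q_def Domain_Un_eq)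
  qed
  have RS: "W - Range (second_edges N) = \<beta> ` (B - g ` B)"
  proof -
    have "Range ((\<lambda>(x, y). (y, h x)) ` N) = h ` P" using N(2) by force
    then have "Range (second_edges N) = Range S0 \<union> h ` P" by (simp add: second_edges_def Range_Un_eq)
    moreover have "MG \<inter> (Range S0 \<union> h ` P) = {}"
    proof -
      have "MG \<inter> h ` \<Omega> = {}" using M by auto
      moreover have "Range S0 \<union> h ` P \<subseteq> MF \<union> h ` \<Omega>" using RS0 XFV P\<Omega> by auto
      ultimately show ?thesis using M_disj by fast
    qed
    moreover have "MG \<subseteq> \<Omega>" using M by blast
    ultimately have "W - Range (second_edges N) = MG - XG"
      using W_in by (auto simp: W_def)
    then show ?thesis by (simp only: MGXG)
  qed
  have "V \<noteq> {}" "W \<noteq> {}" using q subs by blast+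
  obtain a where a: "bij_betw a \<Omega> \<Omega>" "\<And>u. u \<in> \<Omega> - A \<Longrightarrow> a u = \<alpha> u"
    "\<And>u. u \<in> A \<Longrightarrow> (a u, a (f u)) \<in> first_edges N"
    using conjugation_from_chain[OF fchain(2,1,3) \<alpha>_inj \<alpha>\<Omega> _ \<open>V \<noteq> {}\<close> ed(3,1,2) DE EN RE]
    by (auto simp: V_def XF_def)
  obtain b where b: "bij_betw b \<Omega> \<Omega>" "\<And>x. x \<in> \<Omega> - B \<Longrightarrow> b x = \<beta> x"
    "\<And>x. x \<in> B \<Longrightarrow> (b x, b (g x)) \<in> second_edges N"
    using conjugation_from_chain[OF gchain(2,1,3) \<beta>_inj \<beta>\<Omega> _ \<open>W \<noteq> {}\<close> ed(6,4,5) DS SN RS]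
    by (auto simp: W_def XG_def)
  have second: "b (g x) = y" if x: "x \<in> \<Omega>" and y: "(b x, y) \<in> second_edges N" for x y
  proof -
    have "b x \<in> W" using y ed(6) by blast
    then have "x \<in> B" using b(2)[of x] x by (auto simp: W_def XG_def)
    from b(3)[OF this] y show ?thesis using ed(4) by (auto dest: single_valuedD)
  qed
  \<comment> \<open>The three origins of an edge of \<open>F\<close> each have their case: the copy of \<open>f\<close>, the set \<open>E0\<close>, and \<open>N\<close>.\<close>
  have "b (g x) = h (a u)" if u: "u \<in> \<Omega>" and x: "x \<in> \<Omega>" and ux: "a (f u) = b x" for u x
  proof (cases "u \<in> A")
    case False
    then have "a u = \<alpha> u" "a (f u) = \<alpha> (f u)" using a(2) fchain(3) u by auto
    then have "(b x, h (a u)) \<in> S0" using ux u False by (auto simp: S0_def)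
    then show ?thesis using second[OF x] by (simp add: second_edges_def)
  next
    case True
    then have "(a u, b x) \<in> E0 \<or> (a u, b x) \<in> N" using a(3)[of u] ux by (simp add: first_edges_def)
    then show ?thesis
    proof
      assume "(a u, b x) \<in> E0"
      then obtain t where t: "t \<in> \<Omega> - B" "a u = c (8 * n (g t) + 3)" "b x = \<beta> t"
        by (auto simp: E0_def)
      then have "b x = b t" using b(2) by simp
      then have "x = t" using b(1) x t(1) by (auto simp: bij_betw_def dest: inj_onD)
      moreover have "b (g t) = \<beta> (g t)" using b(2) gchain(3) t(1) by blast
      moreover have "\<beta> (g t) = h (a u)" using t by (simp add: \<beta>_def hc3)
      ultimately show ?thesis by simp
    next
      assume "(a u, b x) \<in> N"
      then have "(b x, h (a u)) \<in> second_edges N" by (force simp: second_edges_def)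
      then show ?thesis by (rule second[OF x])
    qed
  qed
  then show ?thesis using a(1) b(1) by blast
qed

section \<open>Counting missed points\<close>

lemma card_missed_comp:
  assumes F: "F ` \<Omega> \<subseteq> \<Omega>" and G: "G ` \<Omega> \<subseteq> \<Omega>" "inj_on G \<Omega>"
  shows "|\<Omega> - F ` \<Omega>| +c |\<Omega> - G ` \<Omega>| =o |\<Omega> - (G \<circ> F) ` \<Omega>|"
proof -
  let ?t = "\<lambda>s. case s of Inl u \<Rightarrow> G u | Inr w \<Rightarrow> w"
  have "inj_on ?t ((\<Omega> - F ` \<Omega>) <+> (\<Omega> - G ` \<Omega>))"
    by (rule inj_onI) (use G(2) in \<open>auto dest: inj_onD\<close>)
  moreover have "?t ` ((\<Omega> - F ` \<Omega>) <+> (\<Omega> - G ` \<Omega>)) = G ` (\<Omega> - F ` \<Omega>) \<union> (\<Omega> - G ` \<Omega>)"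
    by (simp add: Plus_def image_Un image_image)
  moreover have "G ` (\<Omega> - F ` \<Omega>) = G ` \<Omega> - G ` F ` \<Omega>"
    using inj_on_image_set_diff[OF G(2), of \<Omega> "F ` \<Omega>"] F by auto
  moreover have "G ` \<Omega> - G ` F ` \<Omega> \<union> (\<Omega> - G ` \<Omega>) = \<Omega> - (G \<circ> F) ` \<Omega>"
    using F G(1) by (auto simp: image_comp)
  ultimately have "bij_betw ?t ((\<Omega> - F ` \<Omega>) <+> (\<Omega> - G ` \<Omega>)) (\<Omega> - (G \<circ> F) ` \<Omega>)"
    by (simp add: bij_betw_def)
  then show ?thesis unfolding csum_def Field_card_of card_of_ordIso[symmetric] by blast
qed

lemma card_missed_conj:
  assumes "a permutes \<Omega>"
  shows "|\<Omega> - (inv a \<circ> f \<circ> a) ` \<Omega>| =o |\<Omega> - f ` \<Omega>|"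
proof -
  have p: "inv a permutes \<Omega>" using assms by (rule permutes_inv)
  have "(inv a \<circ> f \<circ> a) ` \<Omega> = inv a ` f ` a ` \<Omega>" by (simp add: image_comp)
  then have "inv a ` (\<Omega> - f ` \<Omega>) = \<Omega> - (inv a \<circ> f \<circ> a) ` \<Omega>"
    using permutes_image[OF p] permutes_image[OF assms] permutes_inj[OF p]
    by (simp add: image_set_diff)
  then have "bij_betw (inv a) (\<Omega> - f ` \<Omega>) (\<Omega> - (inv a \<circ> f \<circ> a) ` \<Omega>)"
    using permutes_inj_on[OF p] by (simp add: bij_betw_def)
  then have "|\<Omega> - f ` \<Omega>| =o |\<Omega> - (inv a \<circ> f \<circ> a) ` \<Omega>|" using card_of_ordIso by blast
  then show ?thesis by (rule ordIso_symmetric)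
qed

theorem theorem9:
  fixes \<Omega> :: "'a set" and f g h :: "'a \<Rightarrow> 'a"
  assumes "countable \<Omega>" and "infinite \<Omega>"
    and "f \<in> Inj \<Omega>" and "g \<in> Inj \<Omega>" and "h \<in> Inj \<Omega>"
    and "has_infinite_cycle \<Omega> f" and "has_infinite_cycle \<Omega> g" and "has_infinite_cycle \<Omega> h"
  shows "(\<exists>a\<in>Sym \<Omega>. \<exists>b\<in>Sym \<Omega>. h = a \<Zcomp> f \<Zcomp> inv a \<Zcomp> b \<Zcomp> g \<Zcomp> inv b)
     \<longleftrightarrow> |\<Omega> - f ` \<Omega>| +c |\<Omega> - g ` \<Omega>| =o |\<Omega> - h ` \<Omega>|"
proof
  assume "\<exists>a\<in>Sym \<Omega>. \<exists>b\<in>Sym \<Omega>. h = a \<Zcomp> f \<Zcomp> inv a \<Zcomp> b \<Zcomp> g \<Zcomp> inv b"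
  then obtain a b where ab: "a permutes \<Omega>" "b permutes \<Omega>"
    and h: "h = (inv b \<circ> g \<circ> b) \<circ> (inv a \<circ> f \<circ> a)"
    by (auto simp: Sym_def comp_assoc)
  have maps: "(inv c \<circ> k \<circ> c) ` \<Omega> \<subseteq> \<Omega>" "inj_on (inv c \<circ> k \<circ> c) \<Omega>"
    if c: "c permutes \<Omega>" and k: "k \<in> Inj \<Omega>" for c k
  proof -
    have im: "c ` \<Omega> = \<Omega>" "inv c ` \<Omega> = \<Omega>"
      using permutes_image[OF c] permutes_image[OF permutes_inv[OF c]] .
    have k': "k ` \<Omega> \<subseteq> \<Omega>" "inj_on k \<Omega>" using k by (auto simp: Inj_def)
    show "(inv c \<circ> k \<circ> c) ` \<Omega> \<subseteq> \<Omega>" unfolding image_comp[symmetric] using im k'(1) by blast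
    show "inj_on (inv c \<circ> k \<circ> c) \<Omega>"
      using permutes_inj_on[OF c] permutes_inj_on[OF permutes_inv[OF c]] im(1) k'(2)
      by (intro comp_inj_on) auto
  qed
  have "|\<Omega> - f ` \<Omega>| +c |\<Omega> - g ` \<Omega>|
      =o |\<Omega> - (inv a \<circ> f \<circ> a) ` \<Omega>| +c |\<Omega> - (inv b \<circ> g \<circ> b) ` \<Omega>|"
    using card_missed_conj[OF ab(1), of f] card_missed_conj[OF ab(2), of g]
    by (intro csum_cong) (auto intro: ordIso_symmetric)
  also have "|\<Omega> - (inv a \<circ> f \<circ> a) ` \<Omega>| +c |\<Omega> - (inv b \<circ> g \<circ> b) ` \<Omega>| =o |\<Omega> - h ` \<Omega>|"
    unfolding h by (rule card_missed_comp) (use maps ab assms(3,4) in blast)+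
  finally show "|\<Omega> - f ` \<Omega>| +c |\<Omega> - g ` \<Omega>| =o |\<Omega> - h ` \<Omega>|" .
next
  assume "|\<Omega> - f ` \<Omega>| +c |\<Omega> - g ` \<Omega>| =o |\<Omega> - h ` \<Omega>|"
  then obtain \<theta> where \<theta>: "bij_betw \<theta> ((\<Omega> - f ` \<Omega>) <+> (\<Omega> - g ` \<Omega>)) (\<Omega> - h ` \<Omega>)"
    unfolding csum_def Field_card_of card_of_ordIso[symmetric] by blast
  obtain A v where f: "A \<subseteq> \<Omega>" "infinite_chain f A v" "f ` (\<Omega> - A) \<subseteq> \<Omega> - A"
    using infinite_cycle_is_infinite_chain[OF assms(3,6)] by blast
  obtain B w where g: "B \<subseteq> \<Omega>" "infinite_chain g B w" "g ` (\<Omega> - B) \<subseteq> \<Omega> - B"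
    using infinite_cycle_is_infinite_chain[OF assms(4,7)] by blast
  obtain C z where "C \<subseteq> \<Omega>" "infinite_chain h C z"
    using infinite_cycle_is_infinite_chain[OF assms(5,8)] by blast
  then have z: "z \<in> \<Omega>" "inj (\<lambda>n. (h ^^ n) z)" by (auto simp: infinite_chain_def)
  obtain a b where ab: "bij_betw a \<Omega> \<Omega>" "bij_betw b \<Omega> \<Omega>"
    and prod: "\<And>u x. u \<in> \<Omega> \<Longrightarrow> x \<in> \<Omega> \<Longrightarrow> a (f u) = b x \<Longrightarrow> b (g x) = h (a u)"
    using product_of_conjugates[OF assms(1,3-5) f g z \<theta>] by blast
  define p where "p x = (if x \<in> \<Omega> then a x else x)" for x
  define q where "q x = (if x \<in> \<Omega> then b x else x)" for x
  have "bij_betw p \<Omega> \<Omega>" "bij_betw q \<Omega> \<Omega>"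
    using ab by (simp_all add: p_def q_def cong: bij_betw_cong)
  then have p: "p permutes \<Omega>" and q: "q permutes \<Omega>"
    by (auto intro!: bij_imp_permutes simp: p_def q_def)
  have ip: "inv p permutes \<Omega>" and iq: "inv q permutes \<Omega>" using p q by (simp_all add: permutes_inv)
  have out: "f x = x" "g x = x" "h x = x" if "x \<notin> \<Omega>" for x
    using assms(3-5) that by (auto simp: Inj_def)
  have im: "f ` \<Omega> \<subseteq> \<Omega>" "g ` \<Omega> \<subseteq> \<Omega>" using assms(3,4) by (auto simp: Inj_def)
  have "h x = q (g (inv q (p (f (inv p x)))))" for x
  proof (cases "x \<in> \<Omega>")
    case True
    define u where "u = inv p x"
    define y where "y = inv q (p (f u))"
    have u: "u \<in> \<Omega>" "f u \<in> \<Omega>" using True permutes_in_image[OF ip] im(1) by (auto simp: u_def)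
    then have y: "y \<in> \<Omega>" using permutes_in_image[OF iq] permutes_in_image[OF p] by (simp add: y_def)
    have "p u = x" "q y = p (f u)" using p q by (simp_all add: u_def y_def permutes_inverses)
    then have "a u = x" "b y = a (f u)" using u y by (simp_all add: p_def q_def)
    then have "b (g y) = h x" using prod[OF u(1) y] by simp
    then show ?thesis using y im(2) by (auto simp: q_def y_def u_def)
  next
    case False
    then show ?thesis using p q ip iq out by (simp add: permutes_not_in)
  qed
  then have "h = inv p \<Zcomp> f \<Zcomp> inv (inv p) \<Zcomp> inv q \<Zcomp> g \<Zcomp> inv (inv q)"
    by (simp add: fun_eq_iff permutes_inv_inv[OF p] permutes_inv_inv[OF q])
  then show "\<exists>a\<in>Sym \<Omega>. \<exists>b\<in>Sym \<Omega>. h = a \<Zcomp> f \<Zcomp> inv a \<Zcomp> b \<Zcomp> g \<Zcomp> inv b"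
    using ip iq by (auto simp: Sym_def)
qed

end
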